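(* Let $n\ge 1$ and $r\ge 1$ be integers. For $P\in\mathcal{P}(\mathbb{Z}^n)$, the relation $$\mathrm{L}^r(\operatorname{relint}P)=(-1)^{m+r}\sum_{i=1}^{m+r}(-1)^i\,\mathrm{L}^r_i(P)$$ holds, where $m=\dim(P)$.
   Context: $\mathbb{N}$ is the set of non-negative integers. $\mathcal{P}(\mathbb{Z}^n)$ is the set of lattice polytopes in $\mathbb{R}^n$, i.e. convex polytopes with vertices in $\mathbb{Z}^n$ (the empty set is included, with the convention $\dim\emptyset=-1$). $\dim(P)$ is the dimension of the affine hull of $P$ and $\operatorname{relint}P$ is the relative interior of $P$ with respect to its affine hull. $\mathbb{T}^r$ is the vector space of symmetric tensors of rank $r$ on $\mathbb{R}^n$, identified via the scalar product with symmetric $r$-linear functionals on $(\mathbb{R}^n)^r$. For $x\in\mathbb{R}^n$, $x^r\in\mathbb{T}^r$ is given by $x^r(v_1,\dots,v_r)=(x\cdot v_1)\cdots(x\cdot v_r)$. For $P\subset\mathbb{R}^n$ a lattice polytope or the relative interior of one, $\mathrm{L}^r(P)=\frac1{r!}\sum_{x\in P\cap\mathbb{Z}^n}x^r$ (discrete moment tensor). For $r\ge1$, the Ehrhart tensors $\mathrm{L}^r_i:\mathcal{P}(\mathbb{Z}^n)\to\mathbb{T}^r$, $i=1,\dots,n+r$, are the coefficients (which exist and are unique) in $\mathrm{L}^r(kP)=\sum_{i=1}^{n+r}\mathrm{L}^r_i(P)k^i$ for all $k\in\mathbb{N}$ and $P\in\mathcal{P}(\mathbb{Z}^n)$. *)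

theory Defs
  imports "HOL-Analysis.Analysis" "HOL-Combinatorics.Permutations"
begin

definition int_lattice :: "(real ^ 'n) set" where
  "int_lattice = {x. \<forall>i. x $ i \<in> \<int>}"

definition lattice_polytope :: "(real ^ 'n) set \<Rightarrow> bool" where
  "lattice_polytope P \<longleftrightarrow> polytope P \<and> {x. x extreme_point_of P} \<subseteq> int_lattice"

text \<open>
  A tensor of rank \<open>r\<close> is represented by an \<open>r\<close>-linear functional on \<open>r\<close>-tuples of vectors.
  An \<open>r\<close>-tuple is a function on \<open>nat\<close> of which only the values at \<open>0, ..., r - 1\<close> matter;
  the first conjunct below ensures that tensors do not look at the other values.
  Linear combinations of tensors are formed pointwise.
\<close>

type_synonym 'n tensor = "(nat \<Rightarrow> real ^ 'n) \<Rightarrow> real"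

definition sym_tensors :: "nat \<Rightarrow> 'n::finite tensor set" where
  "sym_tensors r = {T.
     (\<forall>v w. (\<forall>j<r. v j = w j) \<longrightarrow> T v = T w) \<and>
     (\<forall>v. \<forall>j<r. linear (\<lambda>x. T (v(j := x)))) \<and>
     (\<forall>v p. p permutes {..<r} \<longrightarrow> T (v \<circ> p) = T v)}"

definition tensor_power :: "nat \<Rightarrow> real ^ 'n \<Rightarrow> 'n::finite tensor" where
  "tensor_power r x = (\<lambda>v. \<Prod>j<r. x \<bullet> v j)"

definition discrete_moment_tensor :: "nat \<Rightarrow> (real ^ 'n) set \<Rightarrow> 'n::finite tensor" where
  "discrete_moment_tensor r P = (\<lambda>v. 1 / fact r * (\<Sum>x \<in> P \<inter> int_lattice. tensor_power r x v))"

definition ehrhart_expansion :: "nat \<Rightarrow> (real ^ 'n) set \<Rightarrow> (nat \<Rightarrow> 'n::finite tensor) \<Rightarrow> bool" where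
  "ehrhart_expansion r P c \<longleftrightarrow>
     (\<forall>i \<in> {1..CARD('n) + r}. c i \<in> sym_tensors r) \<and>
     (\<forall>k::nat. discrete_moment_tensor r ((\<lambda>x. real k *\<^sub>R x) ` P) =
        (\<lambda>v. \<Sum>i = 1..CARD('n) + r. c i v * real k ^ i))"

text \<open>Only meaningful for \<open>r \<ge> 1\<close>, lattice polytopes \<open>P\<close> and \<open>1 \<le> i \<le> CARD('n) + r\<close>.\<close>

definition ehrhart_tensor :: "nat \<Rightarrow> nat \<Rightarrow> (real ^ 'n) set \<Rightarrow> 'n::finite tensor" where
  "ehrhart_tensor r i P = (THE t. \<exists>c. ehrhart_expansion r P c \<and> t = c i)"

lemma tensor_power_in_sym_tensors: "tensor_power r x \<in> sym_tensors r"
proof -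
  have "linear (\<lambda>y. tensor_power r x (v(j := y)))" if "j < r" for v j
  proof -
    have "tensor_power r x (v(j := y)) = (\<Prod>l\<in>{..<r} - {j}. x \<bullet> v l) * (x \<bullet> y)" for y
      using that by (simp add: tensor_power_def prod.remove[of "{..<r}" j])
    then show ?thesis
      by (simp add: linear_iff inner_add_right algebra_simps)
  qed
  moreover have "tensor_power r x (v \<circ> p) = tensor_power r x v" if "p permutes {..<r}" for v p
    using prod.permute[OF that, of "\<lambda>j. x \<bullet> v j"] by (simp add: tensor_power_def o_def)
  ultimately show ?thesis
    by (auto simp: sym_tensors_def tensor_power_def)
qed

lemma discrete_moment_tensor_in_sym_tensors: "discrete_moment_tensor r P \<in> sym_tensors r"
  for P :: "(real ^ 'n) set"
proof -
  have lin: "linear (\<lambda>y. tensor_power r x (v(j := y)))" if "j < r" for x :: "real ^ 'n" and v j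
    using that tensor_power_in_sym_tensors[of r x] by (auto simp: sym_tensors_def)
  have "linear (\<lambda>y. discrete_moment_tensor r P (v(j := y)))" if "j < r" for v j
    unfolding discrete_moment_tensor_def real_scaleR_def[symmetric]
    by (intro linear_compose_scale_right linear_compose_sum ballI lin that)
  moreover have "discrete_moment_tensor r P v = discrete_moment_tensor r P w"
    if "\<forall>j<r. v j = w j" for v w
    using that by (simp add: discrete_moment_tensor_def tensor_power_def)
  moreover have "discrete_moment_tensor r P (v \<circ> p) = discrete_moment_tensor r P v"
    if "p permutes {..<r}" for v p
  proof -
    have "tensor_power r x (v \<circ> p) = tensor_power r x v" for x :: "real ^ 'n"
      using that tensor_power_in_sym_tensors[of r x] by (auto simp: sym_tensors_def)
    then show ?thesis
      by (simp add: discrete_moment_tensor_def)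
  qed
  ultimately show ?thesis
    by (auto simp: sym_tensors_def)
qed

lemma ehrhart_expansion_unique:
  fixes P :: "(real ^ 'n) set"
  assumes c: "ehrhart_expansion r P c" and d: "ehrhart_expansion r P d"
    and i: "i \<in> {1..CARD('n) + r}"
  shows "c i = d i"
proof
  fix v
  let ?N = "CARD('n) + r"
  define a where "a = (\<lambda>j. if j = 0 then 0 else c j v - d j v)"
  have *: "(\<Sum>j\<le>?N. a j * real k ^ j) = 0" for k
  proof -
    have "(\<Sum>j\<le>?N. a j * real k ^ j) = (\<Sum>j = 1..?N. (c j v - d j v) * real k ^ j)"
      by (rule sum.mono_neutral_cong_right) (auto simp: a_def)
    also have "\<dots> = (\<Sum>j = 1..?N. c j v * real k ^ j) - (\<Sum>j = 1..?N. d j v * real k ^ j)"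
      by (simp add: left_diff_distrib sum_subtractf)
    also have "\<dots> = 0"
      using c d unfolding ehrhart_expansion_def by (metis diff_self)
    finally show ?thesis .
  qed
  have "infinite (range real)"
    by (simp add: finite_image_iff inj_on_def)
  then have "infinite {z. (\<Sum>j\<le>?N. a j * z ^ j) = 0}"
    by (rule infinite_super[rotated]) (use * in auto)
  then have "a i = 0"
    using polyfun_finite_roots[of a ?N] i by auto
  with i show "c i v = d i v"
    by (simp add: a_def)
qed

lemma ehrhart_tensor_eq:
  fixes P :: "(real ^ 'n) set"
  assumes "ehrhart_expansion r P c" "i \<in> {1..CARD('n) + r}"
  shows "ehrhart_tensor r i P = c i"
  unfolding ehrhart_tensor_def using assms ehrhart_expansion_unique by blast

end

theory Submission
  imports Defs "HOL-Analysis.Analysis" "HOL-Computational_Algebra.Polynomial"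
begin

text \<open>
  For a fixed argument \<open>v\<close> the tensors become sums of the polynomial \<open>f x = (x \<bullet> v 0) \<cdots> (x \<bullet> v (r - 1))\<close>,
  homogeneous of degree \<open>r\<close>, over lattice points. The sum over the lattice points of \<open>k P\<close> is shown to be a
  polynomial \<open>p\<close> in \<open>k\<close> of degree at most \<open>m + r\<close> without constant term, and the sum over the relative interior of
  \<open>P\<close> to be \<open>(-1)^(m + r) p (-1)\<close>. The Ehrhart tensors evaluated at \<open>v\<close> are the coefficients of \<open>p\<close>, so this is the claim.

  The proof follows the approach to Ehrhart--Macdonald reciprocity by half-open simplices. For a lattice
  simplex with some facets removed, the lattice points in the cone over it split uniquely into a point of a
  finite fundamental box and a natural combination of the vertices. This expresses the sum of \<open>f\<close> by sums of
  polynomials over the compositions of an integer, which are polynomials with an explicit reciprocity law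
  (\<open>reciprocal_sums_affine_prod\<close>). Evaluating at \<open>-1\<close> reflects the fundamental box, which amounts to
  exchanging the removed and the kept facets (\<open>half_open_simplex_reciprocity\<close>).

  A polytope is triangulated without new vertices (\<open>exists_triangulation\<close>). Seen from a generic point \<open>q\<close> in its
  relative interior, it is the disjoint union of half-open simplices, and its relative interior is the disjoint
  union of the same simplices with the complementary facets removed (\<open>exists_half_open_decomposition\<close>).
  Hence the reciprocity of half-open simplices adds up to the reciprocity of the polytope, with no
  inclusion-exclusion over faces.
\<close>

section \<open>Sums of polynomials over compositions\<close>

text \<open>
  The total is an integer and the functions vanish off \<open>S\<close>: a negative total then gives the empty
  set, so that sums over a shifted total need no case distinction, and the set is finite.
\<close>

definition compositions :: "'a set \<Rightarrow> int \<Rightarrow> ('a \<Rightarrow> nat) set" where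
  "compositions S k = {n. (\<forall>i. i \<notin> S \<longrightarrow> n i = 0) \<and> int (sum n S) = k}"

lemma compositions_neg: "k < 0 \<Longrightarrow> compositions S k = {}"
  by (auto simp: compositions_def simp del: of_nat_sum)

lemma mem_compositions:
  "n \<in> compositions S (int k) \<longleftrightarrow> (\<forall>i. i \<notin> S \<longrightarrow> n i = 0) \<and> sum n S = k"
  unfolding compositions_def by (simp del: of_nat_sum)

lemma compositions_singleton: "compositions {s} (int k) = {(\<lambda>_. 0)(s := k)}"
  by (auto simp: compositions_def)

lemma finite_compositions:
  assumes "finite S"
  shows "finite (compositions S k)"
proof (rule finite_subset)
  show "compositions S k \<subseteq> {n. \<forall>i. (i \<in> S \<longrightarrow> n i \<in> {..nat k}) \<and> (i \<notin> S \<longrightarrow> n i = 0)}"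
    using assms by (auto simp: compositions_def simp del: of_nat_sum intro!: member_le_sum)
  show "finite {n. \<forall>i. (i \<in> S \<longrightarrow> n i \<in> {..nat k}) \<and> (i \<notin> S \<longrightarrow> n i = 0)}"
    by (rule finite_set_of_finite_funs) (use assms in auto)
qed

lemma sum_compositions_insert:
  assumes "finite S" "s \<notin> S"
  shows "(\<Sum>n\<in>compositions (insert s S) (int k). g n) =
    (\<Sum>j\<le>k. \<Sum>n\<in>compositions S (int (k - j)). g (n(s := j)))"
proof -
  have eq: "(\<Sum>i\<in>S. if i = s then j else n i) = sum n S" for n :: "'a \<Rightarrow> nat" and j
    using assms by (intro sum.cong) auto
  have "(\<Sum>j\<le>k. \<Sum>n\<in>compositions S (int (k - j)). g (n(s := j))) =
      (\<Sum>(j, n)\<in>(SIGMA j:{..k}. compositions S (int (k - j))). g (n(s := j)))"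
    using assms by (subst sum.Sigma) (auto intro: finite_compositions)
  also have "\<dots> = (\<Sum>n\<in>compositions (insert s S) (int k). g n)"
    by (rule sum.reindex_bij_witness
          [where i = "\<lambda>n. (n s, n(s := 0))" and j = "\<lambda>(j, n). n(s := j)"])
       (use assms in \<open>auto simp: mem_compositions eq fun_upd_idem simp del: of_nat_diff of_nat_sum\<close>)
  finally show ?thesis by simp
qed

text \<open>
  The coefficient of \<open>z^k\<close> in \<open>1/(1-z)^(a+1) \<cdot> 1/(1-z)^(b+1)\<close>; here by Pascal's rule in \<open>b\<close> and \<open>k\<close>.
\<close>

lemma sum_binomial_convolution:
  "(\<Sum>j\<le>k. (j + a choose a) * (k - j + b choose b)) = (k + a + b + 1 choose (a + b + 1))"
proof (induction b arbitrary: k)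
  case 0
  have "(\<Sum>j\<le>k. j + a choose a) = (k + a + 1 choose (a + 1))"
    by (induction k) auto
  then show ?case by simp
next
  case (Suc b)
  show ?case
  proof (induction k)
    case 0
    show ?case by simp
  next
    case (Suc k)
    have "(\<Sum>j\<le>k. (j + a choose a) * (Suc k - j + Suc b choose Suc b)) =
      (\<Sum>j\<le>k. (j + a choose a) * (Suc k - j + b choose b)) +
      (\<Sum>j\<le>k. (j + a choose a) * (k - j + Suc b choose Suc b))"
      unfolding sum.distrib[symmetric]
      by (intro sum.cong) (simp_all add: distrib_left[symmetric] Suc_diff_le)
    then have "(\<Sum>j\<le>Suc k. (j + a choose a) * (Suc k - j + Suc b choose Suc b)) =
      (\<Sum>j\<le>Suc k. (j + a choose a) * (Suc k - j + b choose b)) +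
      (\<Sum>j\<le>k. (j + a choose a) * (k - j + Suc b choose Suc b))"
      by simp
    then show ?case
      unfolding Suc.IH \<open>\<And>k. (\<Sum>j\<le>k. (j + a choose a) * (k - j + b choose b)) = _\<close>
      by (simp add: algebra_simps)
  qed
qed

text \<open>
  For \<open>a = 0\<close> this is the number of compositions of \<open>k\<close> into \<open>m + 1\<close> parts. In general, one factor
  at a time is split off and absorbed by the convolution identity.
\<close>

lemma sum_compositions_rising:
  assumes "finite S" "card S = Suc m"
  shows "(\<Sum>n\<in>compositions S (int k). \<Prod>i\<in>S. n i + a i choose a i) =
    (k + m + sum a S choose (m + sum a S))"
proof -
  have "S \<noteq> {}" using assms by auto
  with \<open>finite S\<close> show ?thesis using \<open>card S = Suc m\<close>
  proof (induction S arbitrary: k m rule: finite_ne_induct)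
    case (singleton s)
    then show ?case by (simp add: compositions_singleton)
  next
    case (insert s S)
    then obtain m' where m: "m = Suc m'" "card S = Suc m'"
      by (metis card_insert_disjoint card_gt_0_iff diff_Suc_1 gr0_implies_Suc)
    have "(\<Sum>n\<in>compositions (insert s S) (int k). \<Prod>i\<in>insert s S. n i + a i choose a i) =
      (\<Sum>j\<le>k. \<Sum>n\<in>compositions S (int (k - j)). (j + a s choose a s) * (\<Prod>i\<in>S. n i + a i choose a i))"
      unfolding sum_compositions_insert[OF insert.hyps(1,3)]
    proof (intro sum.cong refl)
      fix j n
      have "(\<Prod>i\<in>S. (n(s := j)) i + a i choose a i) = (\<Prod>i\<in>S. n i + a i choose a i)"
        using insert.hyps by (intro prod.cong) auto
      then show "(\<Prod>i\<in>insert s S. (n(s := j)) i + a i choose a i) =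
         (j + a s choose a s) * (\<Prod>i\<in>S. n i + a i choose a i)"
        using insert.hyps by (subst prod.insert) auto
    qed
    also have "\<dots> = (\<Sum>j\<le>k. (j + a s choose a s) * (k - j + (m' + sum a S) choose (m' + sum a S)))"
      unfolding sum_distrib_left[symmetric] insert.IH[OF m(2)] by (simp add: add.assoc)
    also have "\<dots> = (k + m + sum a (insert s S) choose (m + sum a (insert s S)))"
      unfolding sum_binomial_convolution using insert.hyps m by (simp add: algebra_simps)
    finally show ?case .
  qed
qed

text \<open>
  Only compositions with \<open>a \<le> n\<close> contribute, and subtracting \<open>a\<close> from these turns the falling
  products into the rising ones, for the total \<open>k - sum a S\<close>.
\<close>

lemma sum_compositions_falling:
  assumes "finite S" "card S = Suc m"
  shows "(\<Sum>n\<in>compositions S (int k). \<Prod>i\<in>S. n i choose a i) = (k + m choose (m + sum a S))"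
proof (cases "sum a S \<le> k")
  case True
  let ?A = "{n \<in> compositions S (int k). \<forall>i\<in>S. a i \<le> n i}"
  have "(\<Sum>n\<in>compositions S (int k). \<Prod>i\<in>S. n i choose a i) = (\<Sum>n\<in>?A. \<Prod>i\<in>S. n i choose a i)"
    using assms by (intro sum.mono_neutral_right) (auto simp: finite_compositions not_le)
  also have "\<dots> = (\<Sum>n\<in>compositions S (int (k - sum a S)). \<Prod>i\<in>S. n i + a i choose a i)"
    by (rule sum.reindex_bij_witness[where
          i = "\<lambda>n i. if i \<in> S then n i + a i else 0" and j = "\<lambda>n i. if i \<in> S then n i - a i else 0"])
       (use True in \<open>auto simp: mem_compositions sum.distrib sum_subtractf_nat fun_eq_iff
          simp del: of_nat_diff of_nat_sum intro!: prod.cong\<close>)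
  also have "\<dots> = (k + m choose (m + sum a S))"
    using True by (subst sum_compositions_rising[OF assms]) (simp add: algebra_simps)
  finally show ?thesis .
next
  case False
  have "(\<Prod>i\<in>S. n i choose a i) = 0" if n: "n \<in> compositions S (int k)" for n
  proof -
    have "sum n S < sum a S" using n False by (simp add: mem_compositions)
    then obtain i where "i \<in> S" "n i < a i" by (meson not_le sum_mono)
    then show ?thesis using assms by auto
  qed
  then show ?thesis using False by simp
qed

text \<open>
  The algebraic core of reciprocity. Summing \<open>g\<close> over the compositions of \<open>k\<close> into \<open>s = card S\<close> parts
  is a polynomial \<open>p\<close> in \<open>k\<close>, and its values at negative arguments are given by the sums of \<open>g\<close> over the
  opposite orthant \<open>n \<mapsto> -1 - n\<close>. The polynomial is already correct for \<open>-s < k < 0\<close>, where the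
  sums are empty; this is needed for counting points of a fundamental box of height \<open>h < s\<close>, which contribute
  the value at \<open>k - h\<close> also when \<open>k = 0\<close>.
\<close>

definition reciprocal_sums :: "'a set \<Rightarrow> nat \<Rightarrow> (('a \<Rightarrow> int) \<Rightarrow> real) \<Rightarrow> bool" where
  "reciprocal_sums S d g \<longleftrightarrow> (\<exists>p :: real poly. degree p \<le> d \<and>
     (\<forall>k > - int (card S).
       (\<Sum>n\<in>compositions S k. g (\<lambda>i. int (n i))) = poly p (of_int k) \<and>
       (\<Sum>n\<in>compositions S k. g (\<lambda>i. - 1 - int (n i))) =
         (- 1) ^ (card S - 1) * poly p (of_int (- k - int (card S)))))"

lemma reciprocal_sums_mono: "reciprocal_sums S d g \<Longrightarrow> d \<le> e \<Longrightarrow> reciprocal_sums S e g"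
  unfolding reciprocal_sums_def using le_trans by blast

lemma reciprocal_sums_add:
  assumes "reciprocal_sums S d g" "reciprocal_sums S d h"
  shows "reciprocal_sums S d (\<lambda>n. g n + h n)"
proof -
  from assms obtain p q where "degree p \<le> d" "degree q \<le> d"
    "\<forall>k > - int (card S).
       (\<Sum>n\<in>compositions S k. g (\<lambda>i. int (n i))) = poly p (of_int k) \<and>
       (\<Sum>n\<in>compositions S k. g (\<lambda>i. - 1 - int (n i))) =
         (- 1) ^ (card S - 1) * poly p (of_int (- k - int (card S)))"
    "\<forall>k > - int (card S).
       (\<Sum>n\<in>compositions S k. h (\<lambda>i. int (n i))) = poly q (of_int k) \<and>
       (\<Sum>n\<in>compositions S k. h (\<lambda>i. - 1 - int (n i))) =
         (- 1) ^ (card S - 1) * poly q (of_int (- k - int (card S)))"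
    unfolding reciprocal_sums_def by blast
  then show ?thesis
    unfolding reciprocal_sums_def
    by (intro exI[of _ "p + q"]) (auto simp: sum.distrib degree_add_le distrib_left)
qed

lemma reciprocal_sums_scale:
  assumes "reciprocal_sums S d g"
  shows "reciprocal_sums S d (\<lambda>n. c * g n)"
proof -
  from assms obtain p where "degree p \<le> d"
    "\<forall>k > - int (card S).
       (\<Sum>n\<in>compositions S k. g (\<lambda>i. int (n i))) = poly p (of_int k) \<and>
       (\<Sum>n\<in>compositions S k. g (\<lambda>i. - 1 - int (n i))) =
         (- 1) ^ (card S - 1) * poly p (of_int (- k - int (card S)))"
    unfolding reciprocal_sums_def by blast
  then show ?thesis
    unfolding reciprocal_sums_def
    by (intro exI[of _ "smult c p"]) (auto simp: sum_distrib_left[symmetric])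
qed

lemma reciprocal_sums_sum:
  assumes "finite I" "I \<noteq> {}" "\<And>i. i \<in> I \<Longrightarrow> reciprocal_sums S d (g i)"
  shows "reciprocal_sums S d (\<lambda>n. \<Sum>i\<in>I. g i n)"
  using assms
  by (induction I rule: finite_ne_induct) (auto intro: reciprocal_sums_add)

lemma gbinomial_poly:
  obtains p :: "real poly" where "degree p \<le> d" "\<And>x. poly p x = (x + c) gchoose d"
proof
  let ?p = "smult (1 / fact d) (\<Prod>i<d. [:c - of_nat i, 1:]) :: real poly"
  have "degree (\<Prod>i<d. [:c - of_nat i, 1:]) \<le> (\<Sum>i<d. degree [:c - of_nat i, 1:])"
    using degree_prod_sum_le[of "{..<d}" "\<lambda>i. [:c - of_nat i, 1:]"] by (simp add: o_def)
  then show "degree ?p \<le> d" by simp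
  show "poly ?p x = (x + c) gchoose d" for x
    by (simp add: gbinomial_prod_rev poly_prod algebra_simps atLeast0LessThan)
qed

text \<open>
  For products of binomial coefficients both sums are explicit, and the two formulas are exchanged by
  \<open>(-x gchoose d) = (-1)^d (x + d - 1 gchoose d)\<close>. These products span all polynomial functions of \<open>n\<close>.
\<close>

lemma reciprocal_sums_gbinomial:
  assumes "finite S" "S \<noteq> {}"
  shows "reciprocal_sums S (card S - 1 + sum a S) (\<lambda>n. \<Prod>i\<in>S. of_int (n i) gchoose a i)"
proof -
  define m where "m = card S - 1"
  have m: "card S = Suc m" using assms by (simp add: m_def card_gt_0_iff)
  let ?M = "m + sum a S"
  obtain p :: "real poly" where p: "degree p \<le> ?M" "\<And>x. poly p x = (x + of_nat m) gchoose ?M"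
    using gbinomial_poly[of ?M "of_nat m"] by blast
  have zero: "(of_int x :: real) gchoose ?M = 0" if "0 \<le> x" "x < int m" for x
  proof -
    have "(of_int x :: real) = of_nat (nat x)" using that by simp
    moreover have "nat x choose ?M = 0" using that by simp
    ultimately show ?thesis by (metis binomial_gbinomial of_nat_0)
  qed
  have "(\<Sum>n\<in>compositions S k. \<Prod>i\<in>S. of_int (int (n i)) gchoose a i) = poly p (of_int k) \<and>
       (\<Sum>n\<in>compositions S k. \<Prod>i\<in>S. of_int (- 1 - int (n i)) gchoose a i) =
         (- 1) ^ m * poly p (of_int (- k - int (card S)))" if k: "- int (card S) < k" for k
  proof (cases "k < 0")
    case True
    \<comment> \<open>Both sums are empty, and both values of p are binomial coefficients of a
      natural number below m, hence zero.\<close>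
    have "poly p (of_int k) = of_int (k + int m) gchoose ?M"
      "poly p (of_int (- k - int (card S))) = of_int (- 1 - k) gchoose ?M"
      by (simp_all add: p m algebra_simps)
    then show ?thesis
      using zero[of "k + int m"] zero[of "- 1 - k"] True k m by (simp add: compositions_neg)
  next
    case False
    then obtain l where l: "k = int l" by (metis nonneg_int_cases not_less)
    have 1: "(\<Sum>n\<in>compositions S k. \<Prod>i\<in>S. of_int (int (n i)) gchoose a i) = poly p (of_int k)"
      using arg_cong[OF sum_compositions_falling[OF assms(1) m, where k = l and a = a], of real]
      by (simp add: l p binomial_gbinomial)
    have neg: "of_int (- 1 - int j) gchoose b = (- 1) ^ b * real (j + b choose b)" for j b
      using gbinomial_minus[of "1 + real j" b] by (simp add: binomial_gbinomial algebra_simps)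
    have "(\<Sum>n\<in>compositions S k. \<Prod>i\<in>S. of_int (- 1 - int (n i)) gchoose a i) =
      (- 1) ^ sum a S * real (\<Sum>n\<in>compositions S k. \<Prod>i\<in>S. n i + a i choose a i)"
      unfolding neg by (simp add: prod.distrib sum_distrib_left power_sum)
    also have "\<dots> = (- 1) ^ m * ((- 1) ^ ?M * real (l + ?M choose ?M))"
      unfolding l sum_compositions_rising[OF assms(1) m] by (simp add: power_add add.assoc)
    also have "(- 1) ^ ?M * real (l + ?M choose ?M) = poly p (of_int (- k - int (card S)))"
      unfolding neg[symmetric] p l m by (simp add: algebra_simps)
    finally show ?thesis using 1 by blast
  qed
  then show ?thesis
    unfolding reciprocal_sums_def m_def[symmetric] using p(1) by blast
qed

text \<open>
  The extra binomial factor in the proof makes the induction on \<open>r\<close> work: multiplication by a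
  coordinate \<open>n i\<close> maps a product of binomial coefficients to a combination of two such products,
  raising the degree by at most one.
\<close>

lemma reciprocal_sums_affine_prod:
  assumes "finite S" "S \<noteq> {}"
  shows "reciprocal_sums S (card S - 1 + r)
    (\<lambda>n. \<Prod>j<r. c j + (\<Sum>i\<in>S. of_int (n i) * d i j))"
proof -
  have "reciprocal_sums S (card S - 1 + sum a S + r)
    (\<lambda>n. (\<Prod>j<r. c j + (\<Sum>i\<in>S. of_int (n i) * d i j)) * (\<Prod>i\<in>S. of_int (n i) gchoose a i))" for a
  proof (induction r arbitrary: a)
    case 0
    then show ?case using reciprocal_sums_gbinomial[OF assms, of a] by simp
  next
    case (Suc r)
    let ?A = "\<lambda>j (n :: 'a \<Rightarrow> int). c j + (\<Sum>i\<in>S. of_int (n i) * d i j)"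
    let ?B = "\<lambda>a (n :: 'a \<Rightarrow> int). \<Prod>i\<in>S. (of_int (n i) :: real) gchoose a i"
    let ?P = "\<lambda>n. \<Prod>j<r. ?A j n"
    have step: "of_int (n i) * ?B a n = real (a i) * ?B a n + real (Suc (a i)) * ?B (a(i := Suc (a i))) n"
      if "i \<in> S" for i n
    proof -
      have "?B b n = (of_int (n i) gchoose b i) * (\<Prod>l\<in>S - {i}. of_int (n l) gchoose b l)" for b
        using that assms by (simp add: prod.remove)
      moreover have "(\<Prod>l\<in>S - {i}. of_int (n l) gchoose (a(i := Suc (a i))) l) =
          (\<Prod>l\<in>S - {i}. (of_int (n l) :: real) gchoose a l)"
        by (intro prod.cong) auto
      ultimately show ?thesis
        using gbinomial_mult_1[of "of_int (n i) :: real" "a i"] by (simp add: mult.assoc[symmetric] distrib_right[symmetric])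
    qed
    have sum_upd: "sum (a(i := Suc (a i))) S = Suc (sum a S)" if "i \<in> S" for i
      using that assms by (simp add: sum.remove[of S i])
    have eq: "(\<Prod>j<Suc r. ?A j n) * ?B a n = c r * (?P n * ?B a n) +
      (\<Sum>i\<in>S. d i r * (real (a i) * (?P n * ?B a n) +
         real (Suc (a i)) * (?P n * ?B (a(i := Suc (a i))) n)))" for n
    proof -
      have "(\<Prod>j<Suc r. ?A j n) * ?B a n =
          c r * (?P n * ?B a n) + (\<Sum>i\<in>S. of_int (n i) * d i r) * (?P n * ?B a n)"
        by (simp add: algebra_simps)
      also have "(\<Sum>i\<in>S. of_int (n i) * d i r) * (?P n * ?B a n) =
          (\<Sum>i\<in>S. d i r * (?P n * (of_int (n i) * ?B a n)))"
        unfolding sum_distrib_right by (intro sum.cong) simp_all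
      finally have "(\<Prod>j<Suc r. ?A j n) * ?B a n =
          c r * (?P n * ?B a n) + (\<Sum>i\<in>S. d i r * (?P n * (of_int (n i) * ?B a n)))" .
      then show ?thesis
        by (simp add: step algebra_simps cong: sum.cong)
    qed
    have low: "reciprocal_sums S (card S - 1 + sum a S + Suc r) (\<lambda>n. ?P n * ?B a n)"
      by (rule reciprocal_sums_mono[OF Suc.IH]) simp
    have high: "reciprocal_sums S (card S - 1 + sum a S + Suc r) (\<lambda>n. ?P n * ?B (a(i := Suc (a i))) n)"
      if "i \<in> S" for i
      using Suc.IH[of "a(i := Suc (a i))"] sum_upd[OF that] by simp
    show ?case
      unfolding eq
      by (intro reciprocal_sums_add reciprocal_sums_scale reciprocal_sums_sum low high assms)
  qed
  from this[of "\<lambda>_. 0"] show ?thesis by simp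
qed

section \<open>Half-open lattice simplices\<close>

lemma finite_bounded_Int_int_lattice:
  fixes B :: "(real ^ 'n) set"
  assumes "bounded B"
  shows "finite (B \<inter> int_lattice)"
proof -
  from assms obtain b where b: "\<And>x. x \<in> B \<Longrightarrow> norm x \<le> b"
    by (auto simp: bounded_iff)
  let ?Z = "of_int ` {- \<lceil>b\<rceil>..\<lceil>b\<rceil>} :: real set"
  have "B \<inter> int_lattice \<subseteq> vec_lambda ` {f :: 'n \<Rightarrow> real. \<forall>i. (i \<in> UNIV \<longrightarrow> f i \<in> ?Z) \<and> (i \<notin> UNIV \<longrightarrow> f i = 0)}"
  proof
    fix x assume x: "x \<in> B \<inter> int_lattice"
    have "x $ i \<in> ?Z" for i
    proof -
      from x obtain z where z: "x $ i = of_int z" by (auto simp: int_lattice_def elim: Ints_cases)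
      have "\<bar>x $ i\<bar> \<le> b" using b[of x] x component_le_norm_cart[of x i] by auto
      then have "z \<in> {- \<lceil>b\<rceil>..\<lceil>b\<rceil>}" unfolding z by (auto simp: abs_le_iff) linarith+
      then show ?thesis using z by blast
    qed
    then show "x \<in> vec_lambda ` {f :: 'n \<Rightarrow> real. \<forall>i. (i \<in> UNIV \<longrightarrow> f i \<in> ?Z) \<and> (i \<notin> UNIV \<longrightarrow> f i = 0)}"
      by (intro image_eqI[of _ _ "vec_nth x"]) auto
  qed
  moreover have "finite {f :: 'n \<Rightarrow> real. \<forall>i. (i \<in> UNIV \<longrightarrow> f i \<in> ?Z) \<and> (i \<notin> UNIV \<longrightarrow> f i = 0)}"
    by (rule finite_set_of_finite_funs) auto
  ultimately show ?thesis by (meson finite_imageI finite_subset)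
qed

lemma int_lattice_add: "x \<in> int_lattice \<Longrightarrow> y \<in> int_lattice \<Longrightarrow> x + y \<in> int_lattice"
  and int_lattice_diff: "x \<in> int_lattice \<Longrightarrow> y \<in> int_lattice \<Longrightarrow> x - y \<in> int_lattice"
  and int_lattice_scaleR: "c \<in> \<int> \<Longrightarrow> x \<in> int_lattice \<Longrightarrow> c *\<^sub>R x \<in> int_lattice"
  and int_lattice_0: "0 \<in> int_lattice"
  by (auto simp: int_lattice_def)

definition comb :: "'a set \<Rightarrow> ('a \<Rightarrow> real) \<Rightarrow> 'a::real_vector" where
  "comb \<sigma> \<mu> = (\<Sum>v\<in>\<sigma>. \<mu> v *\<^sub>R v)"

lemma comb_add: "comb \<sigma> (\<lambda>v. \<mu> v + \<nu> v) = comb \<sigma> \<mu> + comb \<sigma> \<nu>"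
  and comb_diff: "comb \<sigma> (\<lambda>v. \<mu> v - \<nu> v) = comb \<sigma> \<mu> - comb \<sigma> \<nu>"
  and comb_scaleR: "comb \<sigma> (\<lambda>v. c * \<mu> v) = c *\<^sub>R comb \<sigma> \<mu>"
  by (simp_all add: comb_def scaleR_add_left sum.distrib scaleR_diff_left sum_subtractf scaleR_sum_right)

lemma comb_cong: "(\<And>v. v \<in> \<sigma> \<Longrightarrow> \<mu> v = \<nu> v) \<Longrightarrow> comb \<sigma> \<mu> = comb \<sigma> \<nu>"
  by (simp add: comb_def)

lemma inner_comb: "comb \<sigma> \<mu> \<bullet> w = (\<Sum>v\<in>\<sigma>. \<mu> v * (v \<bullet> w))"
  by (simp add: comb_def inner_sum_left)

lemma comb_int_lattice:
  assumes "\<sigma> \<subseteq> int_lattice" "\<And>v. v \<in> \<sigma> \<Longrightarrow> \<mu> v \<in> \<int>"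
  shows "comb \<sigma> \<mu> \<in> int_lattice"
proof -
  have "(\<Sum>v\<in>\<sigma>. \<mu> v *\<^sub>R v) \<in> int_lattice" using assms
    by (induction \<sigma> rule: infinite_finite_induct)
       (auto intro: int_lattice_add int_lattice_scaleR int_lattice_0)
  then show ?thesis by (simp add: comb_def)
qed

lemma affine_coordinates_unique:
  assumes "finite \<sigma>" "\<not> affine_dependent \<sigma>" "sum \<mu> \<sigma> = sum \<nu> \<sigma>" "comb \<sigma> \<mu> = comb \<sigma> \<nu>" "v \<in> \<sigma>"
  shows "\<mu> v = \<nu> v"
proof (rule ccontr)
  assume "\<mu> v \<noteq> \<nu> v"
  then have "affine_dependent \<sigma>"
    unfolding affine_dependent_explicit_finite[OF assms(1)]
    using assms comb_diff[of \<sigma> \<mu> \<nu>]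
    by (intro exI[of _ "\<lambda>v. \<mu> v - \<nu> v"]) (auto simp: sum_subtractf comb_def)
  with assms show False by simp
qed

text \<open>
  Points \<open>x = \<Sum> \<mu> v \<cdot> v\<close> of the cone over the simplex \<open>\<sigma>\<close> are represented by their coordinates, which
  avoids choosing an embedding at height one. The slice at height \<open>k\<close> of the half-open cone, in which
  exactly the facets opposite to vertices in \<open>J\<close> are kept, corresponds to the lattice points in the
  \<open>k\<close>-th dilate of the half-open simplex.
\<close>

definition cone_slice :: "(real ^ 'n) set \<Rightarrow> (real ^ 'n) set \<Rightarrow> int \<Rightarrow> (real ^ 'n \<Rightarrow> real) set" where
  "cone_slice \<sigma> J k = {\<mu>. (\<forall>v. v \<notin> \<sigma> \<longrightarrow> \<mu> v = 0) \<and> sum \<mu> \<sigma> = of_int k \<and> comb \<sigma> \<mu> \<in> int_lattice \<and>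
     (\<forall>v\<in>\<sigma>. 0 \<le> \<mu> v \<and> (v \<notin> J \<longrightarrow> 0 < \<mu> v))}"

text \<open>
  The lattice points of the fundamental parallelepiped of the half-open cone: every coordinate
  satisfying \<open>0 \<le> \<mu> v\<close> (for \<open>v \<in> J\<close>) or \<open>0 < \<mu> v\<close> (otherwise) is uniquely a natural number plus an
  element of \<open>{0..<1}\<close> or \<open>{0<..1}\<close>, respectively.
\<close>

definition fundamental_box :: "(real ^ 'n) set \<Rightarrow> (real ^ 'n) set \<Rightarrow> (real ^ 'n \<Rightarrow> real) set" where
  "fundamental_box \<sigma> J = {\<beta>. (\<forall>v. v \<notin> \<sigma> \<longrightarrow> \<beta> v = 0) \<and> sum \<beta> \<sigma> \<in> \<int> \<and> comb \<sigma> \<beta> \<in> int_lattice \<and>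
     (\<forall>v\<in>\<sigma>. if v \<in> J then 0 \<le> \<beta> v \<and> \<beta> v < 1 else 0 < \<beta> v \<and> \<beta> v \<le> 1)}"

lemma inj_on_comb_cone_slice:
  assumes "finite \<sigma>" "\<not> affine_dependent \<sigma>"
  shows "inj_on (comb \<sigma>) (cone_slice \<sigma> J k)"
proof (rule inj_onI, rule ext)
  fix \<mu> \<nu> v assume "\<mu> \<in> cone_slice \<sigma> J k" "\<nu> \<in> cone_slice \<sigma> J k" "comb \<sigma> \<mu> = comb \<sigma> \<nu>"
  then show "\<mu> v = \<nu> v"
    using affine_coordinates_unique[OF assms, of \<mu> \<nu> v] by (cases "v \<in> \<sigma>") (auto simp: cone_slice_def)
qed

lemma finite_cone_slice:
  assumes "finite \<sigma>" "\<not> affine_dependent \<sigma>"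
  shows "finite (cone_slice \<sigma> J k)"
proof -
  define B where "B = (\<Sum>v\<in>\<sigma>. of_int \<bar>k\<bar> * norm v)"
  have "comb \<sigma> ` cone_slice \<sigma> J k \<subseteq> cball 0 B \<inter> int_lattice"
  proof (intro image_subsetI IntI)
    fix \<mu> assume \<mu>: "\<mu> \<in> cone_slice \<sigma> J k"
    then show "comb \<sigma> \<mu> \<in> int_lattice" by (simp add: cone_slice_def)
    have "\<bar>\<mu> v\<bar> \<le> of_int \<bar>k\<bar>" if "v \<in> \<sigma>" for v
      using \<mu> that assms member_le_sum[of v \<sigma> \<mu>] by (auto simp: cone_slice_def)
    then have "norm (comb \<sigma> \<mu>) \<le> B"
      unfolding comb_def B_def by (intro sum_norm_le) (auto intro: mult_right_mono)
    then show "comb \<sigma> \<mu> \<in> cball 0 B" by simp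
  qed
  then have "finite (comb \<sigma> ` cone_slice \<sigma> J k)"
    by (rule finite_subset) (simp add: finite_bounded_Int_int_lattice)
  then show ?thesis using inj_on_comb_cone_slice[OF assms] by (rule finite_imageD)
qed

text \<open>
  If some facet is kept, the height is strictly smaller than the number of vertices. This makes
  the counting polynomial correct at \<open>k = 0\<close> as well.
\<close>

lemma fundamental_box_height:
  assumes "finite \<sigma>" "\<beta> \<in> fundamental_box \<sigma> J"
  shows "0 \<le> \<lfloor>sum \<beta> \<sigma>\<rfloor>" "\<lfloor>sum \<beta> \<sigma>\<rfloor> \<le> int (card \<sigma>)" "of_int \<lfloor>sum \<beta> \<sigma>\<rfloor> = sum \<beta> \<sigma>"
    and "J \<inter> \<sigma> \<noteq> {} \<Longrightarrow> \<lfloor>sum \<beta> \<sigma>\<rfloor> < int (card \<sigma>)"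
proof -
  have b: "0 \<le> \<beta> v" "\<beta> v \<le> 1" "v \<in> J \<Longrightarrow> \<beta> v < 1" if "v \<in> \<sigma>" for v
    using assms that by (auto simp: fundamental_box_def split: if_splits)
  show "0 \<le> \<lfloor>sum \<beta> \<sigma>\<rfloor>" using b by (simp add: sum_nonneg)
  show int: "of_int \<lfloor>sum \<beta> \<sigma>\<rfloor> = sum \<beta> \<sigma>" using assms by (auto simp: fundamental_box_def elim: Ints_cases)
  have "sum \<beta> \<sigma> \<le> (\<Sum>v\<in>\<sigma>. 1)" using b by (intro sum_mono)
  then show "\<lfloor>sum \<beta> \<sigma>\<rfloor> \<le> int (card \<sigma>)" using int by simp linarith
  assume "J \<inter> \<sigma> \<noteq> {}"
  then have "sum \<beta> \<sigma> < (\<Sum>v\<in>\<sigma>. 1)" using b assms by (intro sum_strict_mono_ex1) auto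
  then show "\<lfloor>sum \<beta> \<sigma>\<rfloor> < int (card \<sigma>)" using int by simp linarith
qed

lemma finite_fundamental_box:
  assumes "finite \<sigma>" "\<not> affine_dependent \<sigma>"
  shows "finite (fundamental_box \<sigma> J)"
proof (rule finite_subset)
  show "fundamental_box \<sigma> J \<subseteq> (\<Union>h\<in>{0..int (card \<sigma>)}. cone_slice \<sigma> \<sigma> h)"
  proof
    fix \<beta> assume \<beta>: "\<beta> \<in> fundamental_box \<sigma> J"
    then have "\<beta> \<in> cone_slice \<sigma> \<sigma> \<lfloor>sum \<beta> \<sigma>\<rfloor>"
      using fundamental_box_height(3)[OF assms(1) \<beta>]
      by (auto simp: cone_slice_def fundamental_box_def split: if_splits intro: less_imp_le)
    then show "\<beta> \<in> (\<Union>h\<in>{0..int (card \<sigma>)}. cone_slice \<sigma> \<sigma> h)"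
      using fundamental_box_height(1,2)[OF assms(1) \<beta>] by auto
  qed
qed (use finite_cone_slice[OF assms] in auto)

text \<open>
  Lattice points of the cone are split into a point of the fundamental box and a natural
  combination of the vertices. The vertices being lattice points, the remainder is one too.
\<close>

lemma sum_cone_slice:
  assumes "finite \<sigma>" "\<not> affine_dependent \<sigma>" "\<sigma> \<subseteq> int_lattice"
  shows "(\<Sum>\<mu>\<in>cone_slice \<sigma> J k. F (comb \<sigma> \<mu>)) =
    (\<Sum>\<beta>\<in>fundamental_box \<sigma> J. \<Sum>n\<in>compositions \<sigma> (k - \<lfloor>sum \<beta> \<sigma>\<rfloor>).
        F (comb \<sigma> \<beta> + comb \<sigma> (\<lambda>v. real (n v))))"
proof -
  define fl :: "real ^ 'a \<Rightarrow> real \<Rightarrow> int" where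
    "fl v x = (if v \<in> J then \<lfloor>x\<rfloor> else \<lceil>x\<rceil> - 1)" for v x
  define ip where "ip \<mu> v = (if v \<in> \<sigma> then nat (fl v (\<mu> v)) else 0)" for \<mu> v
  have ip: "real (ip \<mu> v) = of_int (fl v (\<mu> v))" if "\<mu> \<in> cone_slice \<sigma> J k" "v \<in> \<sigma>" for \<mu> v
  proof -
    have "0 \<le> fl v (\<mu> v)" using that by (auto simp: fl_def cone_slice_def)
    then show ?thesis using that by (simp add: ip_def)
  qed
  have ip_add: "ip (\<lambda>v. \<beta> v + real (n v)) = n"
    if "\<beta> \<in> fundamental_box \<sigma> J" "n \<in> compositions \<sigma> l" for \<beta> n l
  proof
    fix v
    show "ip (\<lambda>v. \<beta> v + real (n v)) v = n v"
    proof (cases "v \<in> \<sigma>")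
      case True
      then have "if v \<in> J then 0 \<le> \<beta> v \<and> \<beta> v < 1 else 0 < \<beta> v \<and> \<beta> v \<le> 1"
        using that by (simp add: fundamental_box_def)
      then have "fl v (\<beta> v + real (n v)) = int (n v)"
        by (auto simp: fl_def floor_eq_iff ceiling_eq_iff diff_eq_eq split: if_splits)
      then show ?thesis using True by (simp add: ip_def)
    next
      case False
      then show ?thesis using that by (simp add: ip_def compositions_def)
    qed
  qed
  have comb_nat: "comb \<sigma> (\<lambda>v. real (n v)) \<in> int_lattice" for n
    by (rule comb_int_lattice[OF assms(3)]) simp
  have sum_comp: "sum (\<lambda>v. real (n v)) \<sigma> = of_int l" if "n \<in> compositions \<sigma> l" for n l
    using that by (simp add: compositions_def flip: of_nat_sum)
  have add_mem: "(\<lambda>v. \<beta> v + real (n v)) \<in> cone_slice \<sigma> J k"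
    if "\<beta> \<in> fundamental_box \<sigma> J" "n \<in> compositions \<sigma> (k - \<lfloor>sum \<beta> \<sigma>\<rfloor>)" for \<beta> n
    using that fundamental_box_height(3)[OF assms(1) that(1)] sum_comp[OF that(2)]
    by (auto simp: cone_slice_def fundamental_box_def compositions_def sum.distrib comb_add
        intro!: int_lattice_add comb_nat add_pos_nonneg split: if_splits)
  have rem: "(\<lambda>v. \<mu> v - real (ip \<mu> v)) \<in> fundamental_box \<sigma> J" 
      "ip \<mu> \<in> compositions \<sigma> (k - \<lfloor>sum (\<lambda>v. \<mu> v - real (ip \<mu> v)) \<sigma>\<rfloor>)"
    if \<mu>: "\<mu> \<in> cone_slice \<sigma> J k" for \<mu>
  proof -
    have eq: "sum (\<lambda>v. \<mu> v - real (ip \<mu> v)) \<sigma> = of_int (k - int (sum (ip \<mu>) \<sigma>))"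
      using \<mu> by (simp add: sum_subtractf cone_slice_def)
    have "if v \<in> J then 0 \<le> x - of_int (fl v x) \<and> x - of_int (fl v x) < 1
        else 0 < x - of_int (fl v x) \<and> x - of_int (fl v x) \<le> 1" for v x
      by (simp add: fl_def) linarith
    moreover have "comb \<sigma> (\<lambda>v. \<mu> v - real (ip \<mu> v)) \<in> int_lattice"
      using \<mu> unfolding comb_diff by (intro int_lattice_diff comb_nat) (simp add: cone_slice_def)
    moreover have "sum (\<lambda>v. \<mu> v - real (ip \<mu> v)) \<sigma> \<in> \<int>" unfolding eq by (rule Ints_of_int)
    moreover have "\<mu> v - real (ip \<mu> v) = 0" if "v \<notin> \<sigma>" for v
      using \<mu> that by (simp add: cone_slice_def ip_def)
    ultimately show "(\<lambda>v. \<mu> v - real (ip \<mu> v)) \<in> fundamental_box \<sigma> J"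
      unfolding fundamental_box_def by (simp only: mem_Collect_eq ip[OF \<mu>] cong: ball_cong) blast
    show "ip \<mu> \<in> compositions \<sigma> (k - \<lfloor>sum (\<lambda>v. \<mu> v - real (ip \<mu> v)) \<sigma>\<rfloor>)"
      unfolding eq floor_of_int by (simp add: compositions_def ip_def)
  qed
  have "(\<Sum>\<beta>\<in>fundamental_box \<sigma> J. \<Sum>n\<in>compositions \<sigma> (k - \<lfloor>sum \<beta> \<sigma>\<rfloor>).
        F (comb \<sigma> \<beta> + comb \<sigma> (\<lambda>v. real (n v)))) =
     (\<Sum>(\<beta>, n)\<in>(SIGMA \<beta>:fundamental_box \<sigma> J. compositions \<sigma> (k - \<lfloor>sum \<beta> \<sigma>\<rfloor>)).
        F (comb \<sigma> \<beta> + comb \<sigma> (\<lambda>v. real (n v))))"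
    by (intro sum.Sigma) (auto simp: assms finite_compositions finite_fundamental_box)
  also have "\<dots> = (\<Sum>\<mu>\<in>cone_slice \<sigma> J k. F (comb \<sigma> \<mu>))"
  proof (rule sum.reindex_bij_witness
      [where i = "\<lambda>\<mu>. (\<lambda>v. \<mu> v - real (ip \<mu> v), ip \<mu>)" and j = "\<lambda>(\<beta>, n) v. \<beta> v + real (n v)"], goal_cases)
    case (1 a)
    then show ?case using ip_add by (auto simp: case_prod_unfold)
  next
    case (2 a)
    then show ?case using add_mem by auto
  next
    case (3 \<mu>)
    then show ?case by simp
  next
    case (4 \<mu>)
    then show ?case using rem by auto
  next
    case (5 a)
    then show ?case by (auto simp: comb_add)
  qed
  finally show ?thesis by simp
qed

text \<open>
  The reflection \<open>\<beta> \<mapsto> 1 - \<beta>\<close> exchanges kept and removed facets; it is the geometric source of reciprocity.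
\<close>

lemma bij_betw_fundamental_box_complement:
  assumes "finite \<sigma>" "\<sigma> \<subseteq> int_lattice" "J \<subseteq> \<sigma>"
  shows "bij_betw (\<lambda>\<beta> v. if v \<in> \<sigma> then 1 - \<beta> v else 0) (fundamental_box \<sigma> J) (fundamental_box \<sigma> (\<sigma> - J))"
proof -
  let ?c = "\<lambda>\<beta> v. if v \<in> \<sigma> then 1 - \<beta> v else 0 :: real"
  have mem: "?c \<beta> \<in> fundamental_box \<sigma> (\<sigma> - K)" if \<beta>: "\<beta> \<in> fundamental_box \<sigma> K" for \<beta> K
  proof -
    have "comb \<sigma> (?c \<beta>) = comb \<sigma> (\<lambda>_. 1) - comb \<sigma> \<beta>"
      unfolding comb_diff[symmetric] by (rule comb_cong) simp
    moreover have "sum (?c \<beta>) \<sigma> = of_nat (card \<sigma>) - sum \<beta> \<sigma>"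
      by (simp add: sum_subtractf)
    ultimately show ?thesis
      using \<beta> assms by (auto simp: fundamental_box_def intro!: int_lattice_diff comb_int_lattice split: if_splits)
  qed
  have inv: "?c (?c \<beta>) = \<beta>" if "\<beta> \<in> fundamental_box \<sigma> K" for \<beta> K
    using that by (auto simp: fundamental_box_def)
  have "\<sigma> - (\<sigma> - J) = J" using assms by blast
  then show ?thesis
    using mem[of _ J] mem[of _ "\<sigma> - J"] inv
    by (intro bij_betwI[where g = ?c]) auto
qed

text \<open>
  Each point \<open>\<beta>\<close> of the fundamental box, of height \<open>h\<close>, contributes a sum over the compositions of
  \<open>k - h\<close>, which is a polynomial in \<open>k\<close>. At \<open>k = -1\<close> it becomes a sum over the points
  \<open>\<beta> - \<Sum> (1 + n v) v = - (\<beta>' + \<Sum> n v \<cdot> v)\<close> with \<open>\<beta>' = 1 - \<beta>\<close> in the complementary box, and the sign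
  \<open>(-1)^r\<close> appears because the summand is homogeneous of degree \<open>r\<close>.
\<close>

lemma half_open_simplex_reciprocity:
  fixes w :: "nat \<Rightarrow> real ^ 'n"
  assumes \<sigma>: "finite \<sigma>" "\<not> affine_dependent \<sigma>" "\<sigma> \<subseteq> int_lattice" and J: "J \<subseteq> \<sigma>" "J \<noteq> {}"
  obtains p :: "real poly" where "degree p \<le> card \<sigma> - 1 + r"
    "\<And>k::nat. (\<Sum>\<mu>\<in>cone_slice \<sigma> J (int k). \<Prod>j<r. comb \<sigma> \<mu> \<bullet> w j) = poly p (real k)"
    "(\<Sum>\<mu>\<in>cone_slice \<sigma> (\<sigma> - J) 1. \<Prod>j<r. comb \<sigma> \<mu> \<bullet> w j) = (- 1) ^ (card \<sigma> - 1 + r) * poly p (- 1)"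
proof -
  define f where "f x = (\<Prod>j<r. x \<bullet> w j)" for x
  define h where "h \<beta> = \<lfloor>sum \<beta> \<sigma>\<rfloor>" for \<beta> :: "real ^ 'n \<Rightarrow> real"
  let ?d = "card \<sigma> - 1 + r"
  let ?g = "\<lambda>\<beta> n. f (comb \<sigma> \<beta> + comb \<sigma> (\<lambda>v. of_int (n v)))"
  have "\<sigma> \<noteq> {}" using J by auto
  have "reciprocal_sums \<sigma> ?d (?g \<beta>)" for \<beta>
    using reciprocal_sums_affine_prod[OF \<sigma>(1) \<open>\<sigma> \<noteq> {}\<close>, of r "\<lambda>j. comb \<sigma> \<beta> \<bullet> w j" "\<lambda>v j. v \<bullet> w j"]
    by (simp add: f_def inner_add_left inner_comb)
  then obtain p where p: "\<And>\<beta>. degree (p \<beta>) \<le> ?d"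
    "\<And>\<beta> k. k > - int (card \<sigma>) \<Longrightarrow>
       (\<Sum>n\<in>compositions \<sigma> k. ?g \<beta> (\<lambda>i. int (n i))) = poly (p \<beta>) (of_int k)"
    "\<And>\<beta> k. k > - int (card \<sigma>) \<Longrightarrow>
       (\<Sum>n\<in>compositions \<sigma> k. ?g \<beta> (\<lambda>i. - 1 - int (n i))) =
         (- 1) ^ (card \<sigma> - 1) * poly (p \<beta>) (of_int (- k - int (card \<sigma>)))"
    unfolding reciprocal_sums_def by metis
  define P where "P = (\<Sum>\<beta>\<in>fundamental_box \<sigma> J. pcompose (p \<beta>) [:- of_int (h \<beta>), 1:])"
  have poly_P: "poly P (of_int k) = (\<Sum>\<beta>\<in>fundamental_box \<sigma> J. poly (p \<beta>) (of_int (k - h \<beta>)))" for k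
    by (simp add: P_def poly_sum poly_pcompose)
  show thesis
  proof (rule that[of P])
    show "degree P \<le> ?d"
      unfolding P_def
    proof (rule degree_sum_le)
      show "degree (pcompose (p \<beta>) [:- of_int (h \<beta>), 1:]) \<le> ?d" for \<beta>
        using p(1)[of \<beta>] by (simp add: degree_pcompose)
    qed (rule finite_fundamental_box[OF \<sigma>(1,2)])
    show "(\<Sum>\<mu>\<in>cone_slice \<sigma> J (int k). \<Prod>j<r. comb \<sigma> \<mu> \<bullet> w j) = poly P (real k)" for k
    proof -
      have "int k - h \<beta> > - int (card \<sigma>)" if "\<beta> \<in> fundamental_box \<sigma> J" for \<beta>
        using fundamental_box_height(4)[OF \<sigma>(1) that] J by (simp add: h_def Int_absorb2)
      then have "(\<Sum>\<mu>\<in>cone_slice \<sigma> J (int k). f (comb \<sigma> \<mu>)) = poly P (of_int (int k))"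
        unfolding poly_P sum_cone_slice[OF \<sigma>] h_def[symmetric]
        using p(2) by (intro sum.cong) (simp_all only: of_int_of_nat_eq)
      then show ?thesis by (simp add: f_def)
    qed
    show "(\<Sum>\<mu>\<in>cone_slice \<sigma> (\<sigma> - J) 1. \<Prod>j<r. comb \<sigma> \<mu> \<bullet> w j) = (- 1) ^ ?d * poly P (- 1)"
    proof -
      let ?c = "\<lambda>\<beta> v. if v \<in> \<sigma> then 1 - \<beta> v else 0 :: real"
      have "(\<Sum>\<mu>\<in>cone_slice \<sigma> (\<sigma> - J) 1. f (comb \<sigma> \<mu>)) =
        (\<Sum>\<beta>\<in>fundamental_box \<sigma> J. \<Sum>n\<in>compositions \<sigma> (1 - h (?c \<beta>)).
            f (comb \<sigma> (?c \<beta>) + comb \<sigma> (\<lambda>v. real (n v))))"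
        unfolding sum_cone_slice[OF \<sigma>] h_def
        by (rule sum.reindex_bij_betw[OF bij_betw_fundamental_box_complement[OF \<sigma>(1,3) J(1)], symmetric])
      also have "\<dots> = (\<Sum>\<beta>\<in>fundamental_box \<sigma> J. (- 1) ^ ?d * poly (p \<beta>) (of_int (- 1 - h \<beta>)))"
      proof (rule sum.cong[OF refl])
        fix \<beta> assume \<beta>: "\<beta> \<in> fundamental_box \<sigma> J"
        have h: "1 - h (?c \<beta>) = 1 + h \<beta> - int (card \<sigma>)"
        proof -
          have "sum (?c \<beta>) \<sigma> = of_int (int (card \<sigma>) - h \<beta>)"
            unfolding of_int_diff h_def fundamental_box_height(3)[OF \<sigma>(1) \<beta>] by (simp add: sum_subtractf)
          then show ?thesis unfolding h_def[of "?c \<beta>"] by (simp add: floor_of_int del: of_int_diff)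
        qed
        have "f (comb \<sigma> (?c \<beta>) + comb \<sigma> (\<lambda>v. real (n v))) = (- 1) ^ r * ?g \<beta> (\<lambda>v. - 1 - int (n v))" for n
        proof -
          have "comb \<sigma> (?c \<beta>) + comb \<sigma> (\<lambda>v. real (n v)) =
              (- 1) *\<^sub>R (comb \<sigma> \<beta> + comb \<sigma> (\<lambda>v. of_int (- 1 - int (n v))))"
            unfolding comb_add[symmetric] comb_scaleR[symmetric] by (rule comb_cong) simp
          then show ?thesis
            by (simp only: f_def inner_scaleR_left prod.distrib prod_constant card_lessThan)
        qed
        then have "(\<Sum>n\<in>compositions \<sigma> (1 - h (?c \<beta>)). f (comb \<sigma> (?c \<beta>) + comb \<sigma> (\<lambda>v. real (n v)))) =
          (- 1) ^ r * (\<Sum>n\<in>compositions \<sigma> (1 + h \<beta> - int (card \<sigma>)). ?g \<beta> (\<lambda>v. - 1 - int (n v)))"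
          by (simp only: h sum_distrib_left)
        also have "\<dots> = (- 1) ^ r * ((- 1) ^ (card \<sigma> - 1) * poly (p \<beta>) (of_int (- 1 - h \<beta>)))"
          using fundamental_box_height(1)[OF \<sigma>(1) \<beta>, folded h_def]
          by (subst p(3)) simp_all
        finally show "(\<Sum>n\<in>compositions \<sigma> (1 - h (?c \<beta>)). f (comb \<sigma> (?c \<beta>) + comb \<sigma> (\<lambda>v. real (n v)))) =
          (- 1) ^ ?d * poly (p \<beta>) (of_int (- 1 - h \<beta>))" by (simp add: power_add)
      qed
      also have "\<dots> = (- 1) ^ ?d * poly P (of_int (- 1))"
        unfolding poly_P by (simp add: sum_distrib_left)
      finally show ?thesis by (simp add: f_def)
    qed
  qed
qed

section \<open>Lexicographic triangulations\<close>

text \<open>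
  Positivity in the lexicographic order in which the elements of \<open>V\<close> are listed according to \<open>idx\<close>.
\<close>

definition lexpos :: "'a set \<Rightarrow> ('a \<Rightarrow> nat) \<Rightarrow> ('a \<Rightarrow> real) \<Rightarrow> bool" where
  "lexpos V idx c \<longleftrightarrow> (\<exists>v\<in>V. 0 < c v \<and> (\<forall>u\<in>V. idx u < idx v \<longrightarrow> c u = 0))"

lemma lexpos_total:
  assumes "v \<in> V" "c v \<noteq> 0"
  shows "lexpos V idx c \<or> lexpos V idx (\<lambda>v. - c v)"
proof -
  obtain w where w: "w \<in> V \<and> c w \<noteq> 0" "\<And>u. u \<in> V \<and> c u \<noteq> 0 \<Longrightarrow> idx w \<le> idx u"
    using assms ex_has_least_nat[of "\<lambda>v. v \<in> V \<and> c v \<noteq> 0" v idx] by blast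
  then have "\<forall>u\<in>V. idx u < idx w \<longrightarrow> c u = 0" using not_le by blast
  moreover have "0 < c w \<or> 0 < - c w" using w by auto
  ultimately show ?thesis using w(1) unfolding lexpos_def by auto
qed

lemma lexpos_add:
  assumes "inj_on idx V" "lexpos V idx c" "lexpos V idx d"
  shows "lexpos V idx (\<lambda>v. c v + d v)"
proof -
  from assms obtain v w where
    v: "v \<in> V" "0 < c v" "\<forall>u\<in>V. idx u < idx v \<longrightarrow> c u = 0" and
    w: "w \<in> V" "0 < d w" "\<forall>u\<in>V. idx u < idx w \<longrightarrow> d u = 0"
    unfolding lexpos_def by blast
  consider "idx v < idx w" | "idx w < idx v" | "v = w"
    using assms(1) v w by (meson inj_onD linorder_less_linear)
  then show ?thesis
  proof cases
    case 1
    then have "0 < c v + d v \<and> (\<forall>u\<in>V. idx u < idx v \<longrightarrow> c u + d u = 0)" using v w by auto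
    then show ?thesis using v by (auto simp: lexpos_def)
  next
    case 2
    then have "0 < c w + d w \<and> (\<forall>u\<in>V. idx u < idx w \<longrightarrow> c u + d u = 0)" using v w by auto
    then show ?thesis using w by (auto simp: lexpos_def)
  next
    case 3
    then have "0 < c v + d v \<and> (\<forall>u\<in>V. idx u < idx v \<longrightarrow> c u + d u = 0)" using v w by auto
    then show ?thesis using v by (auto simp: lexpos_def)
  qed
qed

lemma lexpos_asym:
  assumes "inj_on idx V" "lexpos V idx c"
  shows "\<not> lexpos V idx (\<lambda>v. - c v)"
proof
  assume "lexpos V idx (\<lambda>v. - c v)"
  then have "lexpos V idx (\<lambda>v. c v + - c v)" by (rule lexpos_add[OF assms])
  then show False by (simp add: lexpos_def)
qed

lemma lexpos_scale: "lexpos V idx c \<Longrightarrow> 0 < t \<Longrightarrow> lexpos V idx (\<lambda>v. t * c v)"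
  unfolding lexpos_def by (elim bexE, rule_tac x = v in bexI) auto

definition affine_relations :: "'a::real_vector set \<Rightarrow> ('a \<Rightarrow> real) set" where
  "affine_relations V = {c. (\<forall>v. v \<notin> V \<longrightarrow> c v = 0) \<and> sum c V = 0 \<and> comb V c = 0}"

definition convex_coords :: "'a::real_vector set \<Rightarrow> 'a \<Rightarrow> ('a \<Rightarrow> real) set" where
  "convex_coords V x = {\<mu>. (\<forall>v. v \<notin> V \<longrightarrow> \<mu> v = 0) \<and> (\<forall>v\<in>V. 0 \<le> \<mu> v) \<and> sum \<mu> V = 1 \<and> comb V \<mu> = x}"

definition support :: "('a \<Rightarrow> real) \<Rightarrow> 'a set" where
  "support \<mu> = {v. \<mu> v \<noteq> 0}"

text \<open>
  A convex combination with support \<open>\<sigma>\<close> represents a point \<open>x\<close> in the lexicographically largest way if no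
  affine relation among \<open>V\<close> that is nonnegative off \<open>\<sigma>\<close> is lexicographically positive. This condition
  depends on \<open>\<sigma>\<close> only and not on \<open>x\<close>, so the open simplices with rigid vertex set are filled completely
  by such points.
\<close>

definition lex_rigid :: "'a::real_vector set \<Rightarrow> ('a \<Rightarrow> nat) \<Rightarrow> 'a set \<Rightarrow> bool" where
  "lex_rigid V idx \<sigma> \<longleftrightarrow> \<not> (\<exists>c\<in>affine_relations V. lexpos V idx c \<and> (\<forall>v\<in>V - \<sigma>. 0 \<le> c v))"

lemma affine_relations_diff:
  "\<mu> \<in> convex_coords V x \<Longrightarrow> \<nu> \<in> convex_coords V x \<Longrightarrow> (\<lambda>v. \<nu> v - \<mu> v) \<in> affine_relations V"
  by (simp add: affine_relations_def convex_coords_def sum_subtractf comb_diff)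

lemma convex_coords_add:
  assumes "\<mu> \<in> convex_coords V x" "c \<in> affine_relations V" "\<And>v. v \<in> V \<Longrightarrow> 0 \<le> \<mu> v + t * c v"
  shows "(\<lambda>v. \<mu> v + t * c v) \<in> convex_coords V x"
  using assms unfolding affine_relations_def convex_coords_def
  by (simp add: sum.distrib comb_add comb_scaleR flip: sum_distrib_left)

lemma comb_support: "finite V \<Longrightarrow> \<mu> \<in> convex_coords V x \<Longrightarrow>
    support \<mu> \<subseteq> V \<and> sum \<mu> (support \<mu>) = 1 \<and> comb (support \<mu>) \<mu> = x"
proof -
  assume V: "finite V" and \<mu>: "\<mu> \<in> convex_coords V x"
  have sub: "support \<mu> \<subseteq> V" using \<mu> by (auto simp: support_def convex_coords_def)
  moreover have "sum \<mu> (support \<mu>) = sum \<mu> V" "comb (support \<mu>) \<mu> = comb V \<mu>"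
    unfolding comb_def by (intro sum.mono_neutral_left; use V sub in \<open>auto simp: support_def\<close>)+
  ultimately show ?thesis using \<mu> by (simp add: convex_coords_def)
qed

lemma eventually_pos_affine: "0 < a \<Longrightarrow> \<forall>\<^sub>F t in at_right 0. 0 < a + t * (b::real)"
proof -
  assume a: "0 < a"
  have "((\<lambda>t. a + t * b) \<longlongrightarrow> a + 0 * b) (at_right 0)" by (intro tendsto_intros)
  then show ?thesis using a by (intro order_tendstoD) auto
qed

lemma affine_relation_on_subset:
  assumes "finite V" "S \<subseteq> V" "affine_dependent S"
  obtains c where "c \<in> affine_relations V" "lexpos V idx c" "\<And>v. v \<notin> S \<Longrightarrow> c v = 0"
proof -
  have "finite S" using assms finite_subset by blast
  then obtain c w where c: "sum c S = 0" "w \<in> S" "c w \<noteq> 0" "(\<Sum>v\<in>S. c v *\<^sub>R v) = 0"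
    using assms affine_dependent_explicit_finite[of S] by blast
  define d where "d v = (if v \<in> S then c v else 0)" for v
  have "sum d S = sum c S" "comb S d = (\<Sum>v\<in>S. c v *\<^sub>R v)"
    by (simp_all add: d_def comb_def)
  moreover have "sum d S = sum d V" "comb S d = comb V d"
    unfolding comb_def by (intro sum.mono_neutral_left; use assms in \<open>auto simp: d_def\<close>)+
  ultimately have d: "d \<in> affine_relations V"
    using c assms(2) by (auto simp: affine_relations_def d_def)
  then have rel: "(\<lambda>v. t * d v) \<in> affine_relations V" for t
    by (simp add: affine_relations_def comb_scaleR flip: sum_distrib_left)
  consider "lexpos V idx d" | "lexpos V idx (\<lambda>v. - d v)"
    using lexpos_total[of w V d] c assms(2) by (auto simp: d_def)
  then show thesis
  proof cases
    case 1
    then show thesis using d that[of d] by (metis d_def)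
  next
    case 2
    then show thesis using rel[of "- 1"] by (intro that[of "\<lambda>v. - d v"]) (auto simp: d_def)
  qed
qed

text \<open>
  A nontrivial affine relation supported on \<open>\<sigma>\<close>, or its negative, is lexicographically positive.
\<close>

lemma lex_rigid_imp_independent:
  assumes "finite V" "\<sigma> \<subseteq> V" "lex_rigid V idx \<sigma>"
  shows "\<not> affine_dependent \<sigma>"
proof
  assume "affine_dependent \<sigma>"
  from affine_relation_on_subset[OF assms(1,2) this]
  obtain c where "c \<in> affine_relations V" "lexpos V idx c" "\<And>v. v \<notin> \<sigma> \<Longrightarrow> c v = 0" by metis
  then show False using assms(3) unfolding lex_rigid_def by force
qed

text \<open>
  As in Caratheodory's theorem, one moves along an affine relation among the support until a
  coefficient vanishes. The sign of the relation is free, so the combination can be made to grow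
  lexicographically. This replaces a compactness argument for the existence of a maximum.
\<close>

lemma lex_improve_to_independent:
  assumes V: "finite V" "inj_on idx V" and "\<mu> \<in> convex_coords V x"
  shows "\<exists>\<nu>\<in>convex_coords V x. \<not> affine_dependent (support \<nu>) \<and> (\<nu> = \<mu> \<or> lexpos V idx (\<lambda>v. \<nu> v - \<mu> v))"
  using assms(3)
proof (induction "card (support \<mu>)" arbitrary: \<mu> rule: less_induct)
  case less
  show ?case
  proof (cases "affine_dependent (support \<mu>)")
    case False
    then show ?thesis using less.prems by blast
  next
    case True
    let ?S = "support \<mu>"
    have S: "?S \<subseteq> V" "finite ?S" using comb_support[OF V(1) less.prems] finite_subset V by auto
    obtain c where c: "c \<in> affine_relations V" "lexpos V idx c" "\<And>v. v \<notin> ?S \<Longrightarrow> c v = 0"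
      using affine_relation_on_subset[OF V(1) S(1) True, of idx] by blast
    let ?N = "{v \<in> ?S. c v < 0}"
    have "?N \<noteq> {}"
    proof
      assume "?N = {}"
      then have nonneg: "0 \<le> c v" for v using c(3) by (cases "v \<in> ?S") (auto simp: not_less)
      from c(2) obtain w where "w \<in> V" "0 < c w" by (auto simp: lexpos_def)
      then have "0 < sum c V" using nonneg V by (intro sum_pos2) auto
      then show False using c by (simp add: affine_relations_def)
    qed
    \<comment> \<open>the largest step that keeps all coefficients nonnegative\<close>
    define t where "t = Min ((\<lambda>v. \<mu> v / - c v) ` ?N)"
    have pos: "0 < \<mu> v" if "v \<in> ?S" for v
      using that less.prems S by (force simp: support_def convex_coords_def less_le)
    have "t \<in> (\<lambda>v. \<mu> v / - c v) ` ?N"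
      unfolding t_def using \<open>?N \<noteq> {}\<close> S by (intro Min_in) auto
    then obtain w where w: "w \<in> ?N" "t = \<mu> w / - c w" by blast
    then have "0 < t" using pos[of w] by (simp add: divide_pos_neg flip: minus_divide_right)
    have le: "t \<le> \<mu> v / - c v" if "v \<in> ?N" for v
      unfolding t_def using that S by (intro Min_le) auto
    have nn: "0 \<le> \<mu> v + t * c v" for v
    proof (cases "v \<in> ?N")
      case True
      then show ?thesis using le[OF True] by (simp add: field_simps)
    next
      case False
      then have "0 \<le> c v" using c(3) by (cases "v \<in> ?S") auto
      moreover have "0 \<le> \<mu> v" using pos[of v] by (cases "v \<in> ?S") (auto simp: support_def)
      ultimately show ?thesis using \<open>0 < t\<close> by simp
    qed
    let ?\<mu> = "\<lambda>v. \<mu> v + t * c v"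
    have mem: "?\<mu> \<in> convex_coords V x"
      by (rule convex_coords_add[OF less.prems c(1) nn])
    have "support ?\<mu> \<subset> ?S"
    proof
      show "support ?\<mu> \<subseteq> ?S" using c(3) by (auto simp: support_def)
      have "w \<notin> support ?\<mu>" using w by (simp add: support_def)
      then show "support ?\<mu> \<noteq> ?S" using w by blast
    qed
    then have "card (support ?\<mu>) < card ?S" using S by (simp add: psubset_card_mono)
    from less.hyps[OF this mem] obtain \<nu> where \<nu>: "\<nu> \<in> convex_coords V x"
      "\<not> affine_dependent (support \<nu>)" "\<nu> = ?\<mu> \<or> lexpos V idx (\<lambda>v. \<nu> v - ?\<mu> v)" by blast
    have tc: "lexpos V idx (\<lambda>v. t * c v)" using c(2) \<open>0 < t\<close> by (rule lexpos_scale)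
    have "lexpos V idx (\<lambda>v. \<nu> v - \<mu> v)"
      using \<nu>(3)
    proof
      assume "lexpos V idx (\<lambda>v. \<nu> v - ?\<mu> v)"
      from lexpos_add[OF V(2) this tc] show ?thesis by simp
    qed (use tc in simp)
    then show ?thesis using \<nu> by blast
  qed
qed

text \<open>
  Among the combinations with independent support, of which there are finitely many, take the
  lexicographically largest. If it were not rigid, a small step along a positive relation followed by
  a reduction to independent support would give a larger one.
\<close>

lemma lex_rigid_coords_exist:
  assumes V: "finite V" "inj_on idx V" and "x \<in> convex hull V"
  obtains \<mu> where "\<mu> \<in> convex_coords V x" "lex_rigid V idx (support \<mu>)"
proof -
  let ?I = "{\<mu> \<in> convex_coords V x. \<not> affine_dependent (support \<mu>)}"
  obtain u where u: "\<forall>v\<in>V. 0 \<le> u v" "sum u V = 1" "(\<Sum>v\<in>V. u v *\<^sub>R v) = x"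
    using assms by (auto simp: convex_hull_finite)
  have "(\<lambda>v. if v \<in> V then u v else 0) \<in> convex_coords V x"
    using u by (auto simp: convex_coords_def comb_def if_distrib cong: if_cong)
  then have "?I \<noteq> {}" using lex_improve_to_independent[OF V] by blast
  moreover have "finite ?I"
  proof (rule finite_imageD)
    show "finite (support ` ?I)"
      by (rule finite_subset[of _ "Pow V"]) (use comb_support[OF V(1)] V in auto)
    show "inj_on support ?I"
    proof (rule inj_onI, rule ext)
      fix \<mu> \<nu> v assume "\<mu> \<in> ?I" "\<nu> \<in> ?I" and eq: "support \<mu> = support \<nu>"
      then show "\<mu> v = \<nu> v"
        using comb_support[OF V(1), of \<mu> x] comb_support[OF V(1), of \<nu> x] V(1)
          affine_coordinates_unique[of "support \<mu>" \<mu> \<nu> v]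
        by (cases "v \<in> support \<mu>") (auto intro: finite_subset simp: support_def)
    qed
  qed
  moreover have "asymp_on ?I (\<lambda>\<mu> \<nu>. lexpos V idx (\<lambda>v. \<nu> v - \<mu> v))"
    using lexpos_asym[OF V(2)] by (intro asymp_onI) fastforce
  moreover have "transp_on ?I (\<lambda>\<mu> \<nu>. lexpos V idx (\<lambda>v. \<nu> v - \<mu> v))"
    using lexpos_add[OF V(2)] by (intro transp_onI) fastforce
  ultimately obtain \<mu> where \<mu>: "\<mu> \<in> ?I"
    "\<And>\<nu>. \<nu> \<in> ?I \<Longrightarrow> \<nu> \<noteq> \<mu> \<Longrightarrow> \<not> lexpos V idx (\<lambda>v. \<nu> v - \<mu> v)"
    using Finite_Set.bex_max_element[of ?I "\<lambda>\<mu> \<nu>. lexpos V idx (\<lambda>v. \<nu> v - \<mu> v)"] by blast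
  have "lex_rigid V idx (support \<mu>)"
    unfolding lex_rigid_def
  proof
    assume "\<exists>c\<in>affine_relations V. lexpos V idx c \<and> (\<forall>v\<in>V - support \<mu>. 0 \<le> c v)"
    then obtain c where c: "c \<in> affine_relations V" "lexpos V idx c" "\<And>v. v \<in> V - support \<mu> \<Longrightarrow> 0 \<le> c v"
      by blast
    have "\<forall>\<^sub>F t in at_right 0. 0 \<le> \<mu> v + t * c v" if "v \<in> V" for v
    proof (cases "v \<in> support \<mu>")
      case True
      then have "0 < \<mu> v" using \<mu>(1) that by (auto simp: convex_coords_def support_def less_le)
      then show ?thesis by (rule eventually_mono[OF eventually_pos_affine[of _ "c v"]]) simp
    next
      case False
      then have "\<mu> v = 0" "0 \<le> c v" using c(3)[of v] that by (auto simp: support_def)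
      then show ?thesis using eventually_at_right_less[of "0::real"] by (auto elim!: eventually_mono)
    qed
    then have "\<forall>\<^sub>F t in at_right 0. \<forall>v\<in>V. 0 \<le> \<mu> v + t * c v"
      using V by (intro eventually_ball_finite) auto
    then have "\<forall>\<^sub>F t in at_right 0. 0 < t \<and> (\<forall>v\<in>V. 0 \<le> \<mu> v + t * c v)"
      using eventually_at_right_less[of "0::real"] by (rule eventually_conj[rotated])
    then obtain t where t: "0 < t" "\<forall>v\<in>V. 0 \<le> \<mu> v + t * c v"
      using eventually_happens[of _ "at_right (0::real)"] by auto
    have "(\<lambda>v. \<mu> v + t * c v) \<in> convex_coords V x"
      using \<mu>(1) c(1) t by (intro convex_coords_add) auto
    from lex_improve_to_independent[OF V this] obtain \<nu> where \<nu>: "\<nu> \<in> ?I"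
      "\<nu> = (\<lambda>v. \<mu> v + t * c v) \<or> lexpos V idx (\<lambda>v. \<nu> v - (\<mu> v + t * c v))" by blast
    have tc: "lexpos V idx (\<lambda>v. t * c v)" using c(2) t(1) by (rule lexpos_scale)
    have "lexpos V idx (\<lambda>v. \<nu> v - \<mu> v)"
      using \<nu>(2)
    proof
      assume "lexpos V idx (\<lambda>v. \<nu> v - (\<mu> v + t * c v))"
      from lexpos_add[OF V(2) this tc] show ?thesis by simp
    qed (use tc in simp)
    moreover from this have "\<nu> \<noteq> \<mu>" by (auto simp: lexpos_def)
    ultimately show False using \<mu>(2)[OF \<nu>(1)] by blast
  qed
  with \<mu> show thesis by (auto intro: that)
qed

text \<open>
  The difference of two rigid combinations of the same point is an affine relation that is nonnegative off
  one support and nonpositive off the other, and it is lexicographically positive or negative.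
\<close>

lemma lex_rigid_coords_unique:
  assumes V: "finite V" "inj_on idx V"
    and "\<mu> \<in> convex_coords V x" "\<nu> \<in> convex_coords V x"
    and rigid: "lex_rigid V idx (support \<mu>)" "lex_rigid V idx (support \<nu>)"
  shows "\<mu> = \<nu>"
proof (rule ccontr)
  assume "\<mu> \<noteq> \<nu>"
  then obtain v where v: "\<nu> v \<noteq> \<mu> v" by force
  then have "v \<in> V" using assms(3,4) by (cases "v \<in> V") (auto simp: convex_coords_def)
  then have "v \<in> V" "\<nu> v - \<mu> v \<noteq> 0" using v by auto
  then consider "lexpos V idx (\<lambda>v. \<nu> v - \<mu> v)" | "lexpos V idx (\<lambda>v. \<mu> v - \<nu> v)"
    using lexpos_total[of v V "\<lambda>v. \<nu> v - \<mu> v"] by auto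
  moreover have "\<forall>v\<in>V - support \<mu>. 0 \<le> \<nu> v - \<mu> v" "\<forall>v\<in>V - support \<nu>. 0 \<le> \<mu> v - \<nu> v"
    using assms by (auto simp: support_def convex_coords_def)
  ultimately show False
    using rigid affine_relations_diff assms unfolding lex_rigid_def by cases blast+
qed

text \<open>
  The open simplices of a triangulation of a polytope that uses no new vertices, obtained by a lexicographic
  choice of convex combinations instead of an induction over faces.
\<close>

lemma exists_triangulation:
  fixes V :: "'a::euclidean_space set"
  assumes "finite V"
  obtains \<Sigma> where "\<And>\<sigma>. \<sigma> \<in> \<Sigma> \<Longrightarrow> \<sigma> \<subseteq> V \<and> \<not> affine_dependent \<sigma>"
    "\<And>x. x \<in> convex hull V \<Longrightarrow> \<exists>\<sigma>\<in>\<Sigma>. x \<in> rel_interior (convex hull \<sigma>)"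
    "\<And>\<sigma> \<tau> x. \<sigma> \<in> \<Sigma> \<Longrightarrow> \<tau> \<in> \<Sigma> \<Longrightarrow> x \<in> rel_interior (convex hull \<sigma>) \<Longrightarrow>
       x \<in> rel_interior (convex hull \<tau>) \<Longrightarrow> \<sigma> = \<tau>"
proof -
  obtain idx :: "'a \<Rightarrow> nat" where idx: "inj_on idx V"
    using finite_imp_inj_to_nat_seg[OF assms] by blast
  let ?\<Sigma> = "{\<sigma>. \<sigma> \<subseteq> V \<and> lex_rigid V idx \<sigma>}"
  have coords: "\<exists>\<mu>\<in>convex_coords V x. support \<mu> = \<sigma>"
    if \<sigma>: "\<sigma> \<in> ?\<Sigma>" and x: "x \<in> rel_interior (convex hull \<sigma>)" for \<sigma> x
  proof -
    have "\<not> affine_dependent \<sigma>" using lex_rigid_imp_independent[OF assms] \<sigma> by blast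
    with x obtain u where u: "\<forall>v\<in>\<sigma>. 0 < u v" "sum u \<sigma> = 1" "(\<Sum>v\<in>\<sigma>. u v *\<^sub>R v) = x"
      by (auto simp: rel_interior_convex_hull_explicit)
    define \<mu> where "\<mu> v = (if v \<in> \<sigma> then u v else 0)" for v
    have "sum \<mu> \<sigma> = sum u \<sigma>" "comb \<sigma> \<mu> = (\<Sum>v\<in>\<sigma>. u v *\<^sub>R v)" by (simp_all add: \<mu>_def comb_def)
    moreover have "sum \<mu> \<sigma> = sum \<mu> V" "comb \<sigma> \<mu> = comb V \<mu>"
      unfolding comb_def by (intro sum.mono_neutral_left; use assms \<sigma> in \<open>auto simp: \<mu>_def\<close>)+
    ultimately have "\<mu> \<in> convex_coords V x"
      using u \<sigma> by (auto simp: convex_coords_def \<mu>_def less_imp_le)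
    moreover have "support \<mu> = \<sigma>" using u(1) by (force simp: support_def \<mu>_def)
    ultimately show ?thesis by blast
  qed
  show thesis
  proof (rule that[of ?\<Sigma>])
    show "\<sigma> \<subseteq> V \<and> \<not> affine_dependent \<sigma>" if "\<sigma> \<in> ?\<Sigma>" for \<sigma>
      using that lex_rigid_imp_independent[OF assms] by blast
    show "\<exists>\<sigma>\<in>?\<Sigma>. x \<in> rel_interior (convex hull \<sigma>)" if x: "x \<in> convex hull V" for x
    proof -
      obtain \<mu> where \<mu>: "\<mu> \<in> convex_coords V x" "lex_rigid V idx (support \<mu>)"
        using lex_rigid_coords_exist[OF assms idx x] by blast
      let ?\<sigma> = "support \<mu>"
      have s: "?\<sigma> \<subseteq> V" "sum \<mu> ?\<sigma> = 1" "comb ?\<sigma> \<mu> = x" using comb_support[OF assms \<mu>(1)] by auto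
      have "\<forall>v\<in>?\<sigma>. 0 < \<mu> v" using \<mu>(1) by (force simp: support_def convex_coords_def less_le)
      then have "x \<in> rel_interior (convex hull ?\<sigma>)"
        using s lex_rigid_imp_independent[OF assms s(1) \<mu>(2)]
        by (auto simp: rel_interior_convex_hull_explicit comb_def)
      then show ?thesis using s \<mu>(2) by blast
    qed
    show "\<sigma> = \<tau>" if "\<sigma> \<in> ?\<Sigma>" "\<tau> \<in> ?\<Sigma>" "x \<in> rel_interior (convex hull \<sigma>)"
       "x \<in> rel_interior (convex hull \<tau>)" for \<sigma> \<tau> x
      using coords[OF that(1,3)] coords[OF that(2,4)] that(1,2)
        lex_rigid_coords_unique[OF assms idx] by (metis (no_types, lifting) mem_Collect_eq)
  qed
qed

section \<open>Half-open decompositions of polytopes\<close>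

lemma affine_contains_line:
  assumes "affine A" "a + s *\<^sub>R d \<in> A" "a + t *\<^sub>R d \<in> A" "s \<noteq> (t :: real)"
  shows "a + u *\<^sub>R d \<in> A"
proof -
  define \<theta> where "\<theta> = (u - s) / (t - s)"
  have "\<theta> * (t - s) = u - s" using assms(4) by (simp add: \<theta>_def)
  then have \<theta>: "(1 - \<theta>) * s + \<theta> * t = u" by (simp add: algebra_simps)
  have "(1 - \<theta>) *\<^sub>R (a + s *\<^sub>R d) + \<theta> *\<^sub>R (a + t *\<^sub>R d) = a + ((1 - \<theta>) * s + \<theta> * t) *\<^sub>R d"
    by (simp add: algebra_simps)
  then show ?thesis using mem_affine[OF assms(1-3), of "1 - \<theta>" \<theta>] by (simp add: \<theta>)
qed

text \<open>
  Join a point missed by one of the sets to a point missed by the others: some set contains two points of the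
  segment, hence the whole line. This supplies points in general position.
\<close>

lemma convex_subset_Union_affine:
  fixes C :: "'a::real_vector set"
  assumes "convex C" "C \<noteq> {}" "finite \<A>" "\<And>A. A \<in> \<A> \<Longrightarrow> affine A" "C \<subseteq> \<Union>\<A>"
  shows "\<exists>A\<in>\<A>. C \<subseteq> A"
  using assms(3,4,5)
proof (induction \<A> rule: finite_induct)
  case empty
  then show ?case using assms(2) by auto
next
  case (insert A \<A>)
  show ?case
  proof (rule ccontr)
    assume neg: "\<not> (\<exists>A\<in>insert A \<A>. C \<subseteq> A)"
    then obtain x where x: "x \<in> C" "x \<notin> A" by blast
    have "\<not> C \<subseteq> \<Union>\<A>" using insert.IH insert.prems(1) neg by blast
    then obtain y where y: "y \<in> C" "y \<notin> \<Union>\<A>" by blast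
    let ?T = "\<lambda>B. {t \<in> {0..1::real}. x + t *\<^sub>R (y - x) \<in> B}"
    have "{0..1} \<subseteq> (\<Union>B\<in>insert A \<A>. ?T B)"
    proof
      fix t :: real assume t: "t \<in> {0..1}"
      then have "(1 - t) *\<^sub>R x + t *\<^sub>R y \<in> C"
        using assms(1) x y by (auto intro: convexD_alt)
      then have "x + t *\<^sub>R (y - x) \<in> C" by (simp add: algebra_simps)
      then show "t \<in> (\<Union>B\<in>insert A \<A>. ?T B)" using insert.prems t by auto
    qed
    moreover have "infinite {0..1::real}" by (simp add: infinite_Icc)
    ultimately have "\<not> finite (\<Union>B\<in>insert A \<A>. ?T B)" using finite_subset by blast
    then obtain B where B: "B \<in> insert A \<A>" "infinite (?T B)"
      using insert.hyps by auto
    then obtain s where s: "s \<in> ?T B" by (metis (no_types, lifting) all_not_in_conv finite.emptyI)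
    have "infinite (?T B - {s})" using B by simp
    then obtain t where t: "t \<in> ?T B" "t \<noteq> s" by (metis (no_types, lifting) Diff_iff all_not_in_conv finite.emptyI insertI1)
    have line: "x + u *\<^sub>R (y - x) \<in> B" for u
      using affine_contains_line[of B x s "y - x" t] insert.prems(1)[OF B(1)] s t by auto
    then have "x \<in> B" "y \<in> B" using line[of 0] line[of 1] by auto
    then show False using x y B by auto
  qed
qed

lemma eventually_not_in_affine:
  fixes q :: "'a::real_normed_vector"
  assumes "affine A" "q \<notin> A" "s \<noteq> (0::real)"
  shows "\<forall>\<^sub>F t in at_right 0. y + (t * s) *\<^sub>R (q - y) \<notin> A"
proof (cases "\<exists>t0. y + (t0 * s) *\<^sub>R (q - y) \<in> A")
  case True
  then obtain t0 where t0: "y + (t0 * s) *\<^sub>R (q - y) \<in> A" by blast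
  have "y + (t * s) *\<^sub>R (q - y) \<notin> A" if "t \<noteq> t0" for t
  proof
    assume "y + (t * s) *\<^sub>R (q - y) \<in> A"
    then have "y + 1 *\<^sub>R (q - y) \<in> A"
      using affine_contains_line[OF assms(1) t0] that assms(3) by fastforce
    then show False using assms(2) by simp
  qed
  then show ?thesis
    using eventually_neq_at_within[of t0 0 "{0<..}"] by (auto elim: eventually_mono)
qed simp

definition half_open_simplex :: "'a set \<Rightarrow> 'a set \<Rightarrow> 'a::real_vector set" where
  "half_open_simplex \<sigma> J = {x. \<exists>\<mu>. (\<forall>v\<in>\<sigma>. 0 \<le> \<mu> v \<and> (v \<notin> J \<longrightarrow> 0 < \<mu> v)) \<and> sum \<mu> \<sigma> = 1 \<and> comb \<sigma> \<mu> = x}"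

lemma half_open_simplex_subset:
  "finite \<sigma> \<Longrightarrow> half_open_simplex \<sigma> J \<subseteq> convex hull \<sigma>"
  by (auto simp: half_open_simplex_def convex_hull_finite comb_def)

text \<open>
  The points \<open>y + t \<cdot> s \<cdot> (q - y)\<close> for small \<open>t > 0\<close> start at \<open>y\<close> and move towards \<open>q\<close> if \<open>s = 1\<close>, away from
  \<open>q\<close> if \<open>s = -1\<close>. Their barycentric coordinates are affine in \<open>t\<close>, so whether they eventually lie in the open
  simplex can be read off: a vanishing coordinate of \<open>y\<close> must become positive, which depends on
  the sign of the coordinate of \<open>q\<close>. Eventually and frequently have the same meaning here, which
  is why the two implications together characterise the half-open simplex.
\<close>

lemma half_open_simplex_visibility:
  fixes \<sigma> :: "'a::euclidean_space set"
  assumes \<sigma>: "finite \<sigma>" "\<not> affine_dependent \<sigma>"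
    and q: "sum \<kappa> \<sigma> = 1" "comb \<sigma> \<kappa> = q" and y: "y \<in> affine hull \<sigma>"
    and K: "K = {v \<in> \<sigma>. 0 < s * \<kappa> v}"
  defines "Q \<equiv> \<lambda>t. y + (t * s) *\<^sub>R (q - y) \<in> rel_interior (convex hull \<sigma>)"
  shows "y \<in> half_open_simplex \<sigma> K \<Longrightarrow> \<forall>\<^sub>F t in at_right 0. Q t"
    and "\<exists>\<^sub>F t in at_right 0. Q t \<Longrightarrow> y \<in> half_open_simplex \<sigma> K"
proof -
  let ?pos = "\<lambda>\<mu> t. \<forall>v\<in>\<sigma>. 0 < \<mu> v + t * (s * (\<kappa> v - \<mu> v))"
  have Q: "Q t \<longleftrightarrow> ?pos \<mu> t" if \<mu>: "sum \<mu> \<sigma> = 1" "comb \<sigma> \<mu> = y" for \<mu> t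
  proof -
    let ?\<nu> = "\<lambda>v. \<mu> v + (t * s) * (\<kappa> v - \<mu> v)"
    have \<nu>: "sum ?\<nu> \<sigma> = 1" "comb \<sigma> ?\<nu> = y + (t * s) *\<^sub>R (q - y)"
      unfolding comb_add comb_scaleR comb_diff sum.distrib sum_distrib_left[symmetric] sum_subtractf
      using \<mu> q by simp_all
    show ?thesis
    proof
      assume "?pos \<mu> t"
      then show "Q t"
        using \<nu> unfolding Q_def rel_interior_convex_hull_explicit[OF \<sigma>(2)] comb_def
        by (intro CollectI exI[of _ ?\<nu>]) (simp add: mult.assoc)
    next
      assume "Q t"
      then obtain u where u: "\<forall>v\<in>\<sigma>. 0 < u v" "sum u \<sigma> = 1" "comb \<sigma> u = y + (t * s) *\<^sub>R (q - y)"
        unfolding Q_def rel_interior_convex_hull_explicit[OF \<sigma>(2)] comb_def by blast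
      then have "u v = ?\<nu> v" if "v \<in> \<sigma>" for v
        using affine_coordinates_unique[OF \<sigma>, of u ?\<nu> v] that \<nu> by simp
      then show "?pos \<mu> t" using u(1) by (simp add: mult.assoc)
    qed
  qed
  {
    assume "y \<in> half_open_simplex \<sigma> K"
    then obtain \<mu> where \<mu>: "\<forall>v\<in>\<sigma>. 0 \<le> \<mu> v \<and> (v \<notin> K \<longrightarrow> 0 < \<mu> v)" "sum \<mu> \<sigma> = 1" "comb \<sigma> \<mu> = y"
      unfolding half_open_simplex_def by blast
    have "\<forall>\<^sub>F t in at_right 0. 0 < \<mu> v + t * (s * (\<kappa> v - \<mu> v))" if "v \<in> \<sigma>" for v
    proof (cases "\<mu> v = 0")
      case True
      then have "0 < s * \<kappa> v" using \<mu>(1) that K by force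
      then show ?thesis using True eventually_at_right_less[of "0::real"]
        by (auto elim!: eventually_mono)
    next
      case False
      then show ?thesis using \<mu>(1) that by (intro eventually_pos_affine) (auto simp: less_le)
    qed
    then show "\<forall>\<^sub>F t in at_right 0. Q t"
      unfolding Q[OF \<mu>(2,3)] using \<sigma>(1) by (intro eventually_ball_finite) auto
  next
    assume freq: "\<exists>\<^sub>F t in at_right 0. Q t"
    obtain \<mu> where \<mu>: "sum \<mu> \<sigma> = 1" "comb \<sigma> \<mu> = y"
      using y unfolding affine_hull_finite[OF \<sigma>(1)] comb_def by blast
    have "0 \<le> \<mu> v \<and> (v \<notin> K \<longrightarrow> 0 < \<mu> v)" if v: "v \<in> \<sigma>" for v
    proof (rule ccontr)
      assume neg: "\<not> (0 \<le> \<mu> v \<and> (v \<notin> K \<longrightarrow> 0 < \<mu> v))"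
      have "\<forall>\<^sub>F t in at_right 0. \<not> 0 < \<mu> v + t * (s * (\<kappa> v - \<mu> v))"
      proof (cases "\<mu> v < 0")
        case True
        then have "\<forall>\<^sub>F t in at_right 0. 0 < - \<mu> v + t * - (s * (\<kappa> v - \<mu> v))"
          by (intro eventually_pos_affine) simp
        then show ?thesis by (rule eventually_mono) simp
      next
        case False
        then have "\<mu> v = 0" "s * \<kappa> v \<le> 0" using neg v K by auto
        then show ?thesis using eventually_at_right_less[of "0::real"]
          by (auto elim!: eventually_mono simp: not_less mult_nonneg_nonpos)
      qed
      then have "\<forall>\<^sub>F t in at_right 0. \<not> Q t"
        unfolding Q[OF \<mu>] using v by (auto elim!: eventually_mono)
      then show False using freq by (simp add: frequently_def)
    qed
    then show "y \<in> half_open_simplex \<sigma> K" using \<mu> unfolding half_open_simplex_def by blast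
  }
qed

text \<open>
  Fix a generic point \<open>q\<close> of the relative interior. A point \<open>y\<close> of the polytope is assigned to the unique
  full-dimensional simplex of the triangulation that contains the points near \<open>y\<close> on the way to \<open>q\<close>; this
  keeps the facets of a simplex \<open>\<sigma>\<close> whose barycentric coordinate is positive at \<open>q\<close> (the set \<open>J \<sigma>\<close>). Moving
  away from \<open>q\<close> instead, one stays in the polytope exactly from points of the relative interior, and
  the complementary facets are kept. Some coordinate of \<open>q\<close> is positive, so \<open>J \<sigma>\<close> is nonempty.
\<close>

lemma exists_half_open_decomposition:
  fixes V :: "'a::euclidean_space set"
  assumes V: "finite V" "V \<noteq> {}"
  obtains T J where "finite T"
    "\<forall>\<sigma>\<in>T. \<sigma> \<subseteq> V \<and> \<not> affine_dependent \<sigma> \<and> int (card \<sigma>) = aff_dim (convex hull V) + 1"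
    "\<forall>\<sigma>\<in>T. J \<sigma> \<subseteq> \<sigma> \<and> J \<sigma> \<noteq> {}"
    "convex hull V = (\<Union>\<sigma>\<in>T. half_open_simplex \<sigma> (J \<sigma>))"
    "disjoint_family_on (\<lambda>\<sigma>. half_open_simplex \<sigma> (J \<sigma>)) T"
    "rel_interior (convex hull V) = (\<Union>\<sigma>\<in>T. half_open_simplex \<sigma> (\<sigma> - J \<sigma>))"
    "disjoint_family_on (\<lambda>\<sigma>. half_open_simplex \<sigma> (\<sigma> - J \<sigma>)) T"
proof -
  define P where "P = convex hull V"
  have P: "convex P" "P \<noteq> {}" "V \<subseteq> P" using V by (auto simp: P_def hull_inc)
  obtain \<Sigma> where \<Sigma>: "\<And>\<sigma>. \<sigma> \<in> \<Sigma> \<Longrightarrow> \<sigma> \<subseteq> V \<and> \<not> affine_dependent \<sigma>"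
    "\<And>x. x \<in> P \<Longrightarrow> \<exists>\<sigma>\<in>\<Sigma>. x \<in> rel_interior (convex hull \<sigma>)"
    "\<And>\<sigma> \<tau> x. \<sigma> \<in> \<Sigma> \<Longrightarrow> \<tau> \<in> \<Sigma> \<Longrightarrow> x \<in> rel_interior (convex hull \<sigma>) \<Longrightarrow>
       x \<in> rel_interior (convex hull \<tau>) \<Longrightarrow> \<sigma> = \<tau>"
    using exists_triangulation[OF V(1)] unfolding P_def by metis
  define T where "T = {\<sigma> \<in> \<Sigma>. aff_dim \<sigma> = aff_dim P}"
  have T: "\<sigma> \<in> \<Sigma>" "\<sigma> \<subseteq> V" "\<not> affine_dependent \<sigma>" "finite \<sigma>" "aff_dim \<sigma> = aff_dim P" if "\<sigma> \<in> T" for \<sigma>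
    using that \<Sigma>(1)[of \<sigma>] finite_subset[OF _ V(1)] by (auto simp: T_def)
  have "finite T" by (rule finite_subset[of _ "Pow V"]) (use T V in auto)
  have aff_T: "affine hull \<sigma> = affine hull P" if "\<sigma> \<in> T" for \<sigma>
  proof (rule affine_dim_equal)
    show "affine hull \<sigma> \<subseteq> affine hull P" using T(2)[OF that] P(3) by (intro hull_mono) auto
    have "aff_dim \<sigma> \<noteq> -1" using T(5)[OF that] P(2) aff_dim_empty[of P] by simp
    then show "affine hull \<sigma> \<noteq> {}" by auto
  qed (use T(5)[OF that] in auto)
  \<comment> \<open>q has to avoid the affine hulls of all lower-dimensional subsets of V; these contain the
    low-dimensional simplices of the triangulation and the facets of the full-dimensional ones.\<close>
  define \<A> where "\<A> = (hull) affine ` {\<tau>. \<tau> \<subseteq> V \<and> aff_dim \<tau> < aff_dim P}"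
  have \<A>: "finite \<A>" "\<And>A. A \<in> \<A> \<Longrightarrow> affine A" using V by (auto simp: \<A>_def)
  obtain q where q: "q \<in> rel_interior P" "q \<notin> \<Union>\<A>"
  proof -
    have "\<not> rel_interior P \<subseteq> \<Union>\<A>"
    proof
      assume "rel_interior P \<subseteq> \<Union>\<A>"
      moreover have "rel_interior P \<noteq> {}" using P rel_interior_eq_empty by blast
      ultimately have "\<exists>A\<in>\<A>. rel_interior P \<subseteq> A"
        using convex_subset_Union_affine[OF convex_rel_interior[OF P(1)] _ \<A>] by simp
      then obtain \<tau> where \<tau>: "aff_dim \<tau> < aff_dim P" "rel_interior P \<subseteq> affine hull \<tau>"
        unfolding \<A>_def by (elim bexE imageE CollectE conjE) (simp add: that)
      have "aff_dim P = aff_dim (rel_interior P)"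
        using rel_interior_same_affine_hull[OF P(1)] aff_dim_affine_hull[of P] aff_dim_affine_hull[of "rel_interior P"] by simp
      also have "\<dots> \<le> aff_dim (affine hull \<tau>)" by (rule aff_dim_subset[OF \<tau>(2)])
      finally show False using \<tau>(1) by simp
    qed
    then obtain q where "q \<in> rel_interior P" "q \<notin> \<Union>\<A>" by (auto simp only: subset_iff)
    then show thesis by (rule that)
  qed
  have qP: "q \<in> P" using q(1) rel_interior_subset[of P] by blast
  then have q_aff: "q \<in> affine hull P" by (rule hull_inc)
  have "\<exists>\<kappa>. sum \<kappa> \<sigma> = 1 \<and> comb \<sigma> \<kappa> = q" if "\<sigma> \<in> T" for \<sigma>
    using q_aff unfolding aff_T[OF that, symmetric] affine_hull_finite[OF T(4)[OF that]] comb_def by blast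
  then obtain \<kappa> where \<kappa>: "\<And>\<sigma>. \<sigma> \<in> T \<Longrightarrow> sum (\<kappa> \<sigma>) \<sigma> = 1" "\<And>\<sigma>. \<sigma> \<in> T \<Longrightarrow> comb \<sigma> (\<kappa> \<sigma>) = q" by metis
  have \<kappa>_nz: "\<kappa> \<sigma> v \<noteq> 0" if \<sigma>: "\<sigma> \<in> T" and v: "v \<in> \<sigma>" for \<sigma> v
  proof
    assume 0: "\<kappa> \<sigma> v = 0"
    let ?\<tau> = "\<sigma> - {v}"
    have "sum (\<kappa> \<sigma>) ?\<tau> = 1" "comb ?\<tau> (\<kappa> \<sigma>) = q"
      using \<kappa>[OF \<sigma>] T(4)[OF \<sigma>] v 0 by (simp_all add: comb_def sum.remove[of \<sigma> v])
    then have "q \<in> affine hull ?\<tau>"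
      using T(4)[OF \<sigma>] by (auto simp: affine_hull_finite comb_def)
    moreover have "?\<tau> \<subseteq> V" using T(2)[OF \<sigma>] by blast
    moreover have "aff_dim ?\<tau> < aff_dim P"
    proof -
      have "\<not> affine_dependent ?\<tau>" using T(3)[OF \<sigma>] by (rule affine_independent_Diff)
      then have "int (card ?\<tau>) = aff_dim ?\<tau> + 1" using aff_dim_affine_independent[of ?\<tau>] by simp
      moreover have "int (card \<sigma>) = aff_dim \<sigma> + 1" using aff_dim_affine_independent[OF T(3)[OF \<sigma>]] by simp
      moreover have "card \<sigma> = Suc (card ?\<tau>)" using T(4)[OF \<sigma>] v by (rule card.remove)
      ultimately show ?thesis using T(5)[OF \<sigma>] by simp
    qed
    ultimately show False using q(2) unfolding \<A>_def by blast
  qed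
  define J where "J \<sigma> = {v \<in> \<sigma>. 0 < \<kappa> \<sigma> v}" for \<sigma>
  have J_compl: "\<sigma> - J \<sigma> = {v \<in> \<sigma>. 0 < - 1 * \<kappa> \<sigma> v}" if "\<sigma> \<in> T" for \<sigma>
    using \<kappa>_nz[OF that] by (auto simp: J_def not_less less_le)
  have J_ne: "J \<sigma> \<noteq> {}" if "\<sigma> \<in> T" for \<sigma>
  proof
    assume "J \<sigma> = {}"
    then have "sum (\<kappa> \<sigma>) \<sigma> \<le> 0" by (intro sum_nonpos) (auto simp: J_def not_less)
    then show False using \<kappa>(1)[OF that] by simp
  qed
  \<comment> \<open>The directions towards q and away from q are treated at once, by the sign s.\<close>
  define K where "K s \<sigma> = {v \<in> \<sigma>. 0 < s * \<kappa> \<sigma> v}" for s :: real and \<sigma>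
  let ?Q = "\<lambda>s y \<sigma> t. y + (t * s) *\<^sub>R (q - y) \<in> rel_interior (convex hull \<sigma>)"
  have vis1: "\<forall>\<^sub>F t in at_right 0. ?Q s y \<sigma> t" if "\<sigma> \<in> T" "y \<in> half_open_simplex \<sigma> (K s \<sigma>)" for s y \<sigma>
  proof -
    have "y \<in> affine hull \<sigma>"
      using that(2) half_open_simplex_subset[OF T(4)[OF that(1)]] convex_hull_subset_affine_hull[of \<sigma>] by blast
    then show ?thesis
      using that by (intro half_open_simplex_visibility(1)[OF T(4,3) \<kappa> _ K_def]) auto
  qed
  have vis2: "y \<in> half_open_simplex \<sigma> (K s \<sigma>)"
    if "\<sigma> \<in> T" "y \<in> affine hull P" "\<exists>\<^sub>F t in at_right 0. ?Q s y \<sigma> t" for s y \<sigma>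
    using that aff_T[OF that(1)] by (intro half_open_simplex_visibility(2)[OF T(4,3) \<kappa> _ K_def]) auto
  have disjoint: "disjoint_family_on (\<lambda>\<sigma>. half_open_simplex \<sigma> (K s \<sigma>)) T" for s
    unfolding disjoint_family_on_def
  proof (intro ballI impI equals0I)
    fix \<sigma> \<tau> y assume st: "\<sigma> \<in> T" "\<tau> \<in> T" "\<sigma> \<noteq> \<tau>"
      and "y \<in> half_open_simplex \<sigma> (K s \<sigma>) \<inter> half_open_simplex \<tau> (K s \<tau>)"
    then have "\<forall>\<^sub>F t in at_right 0. ?Q s y \<sigma> t \<and> ?Q s y \<tau> t"
      by (intro eventually_conj vis1) auto
    then obtain t where "?Q s y \<sigma> t" "?Q s y \<tau> t"
      using eventually_happens[of _ "at_right (0::real)"] by auto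
    then show False using \<Sigma>(3)[OF T(1) T(1)] st by blast
  qed
  have cover: "\<exists>\<sigma>\<in>T. y \<in> half_open_simplex \<sigma> (K s \<sigma>)"
    if "s \<noteq> 0" "y \<in> affine hull P" and inP: "\<forall>\<^sub>F t in at_right 0. y + (t * s) *\<^sub>R (q - y) \<in> P" for s y
  proof -
    have "\<forall>\<^sub>F t in at_right 0. \<forall>A\<in>\<A>. y + (t * s) *\<^sub>R (q - y) \<notin> A"
      using \<A> q(2) that(1) by (intro eventually_ball_finite ballI eventually_not_in_affine) auto
    with inP have "\<forall>\<^sub>F t in at_right 0. \<exists>\<sigma>\<in>T. ?Q s y \<sigma> t"
    proof eventually_elim
      case (elim t)
      then obtain \<sigma> where \<sigma>: "\<sigma> \<in> \<Sigma>" "?Q s y \<sigma> t" using \<Sigma>(2) by blast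
      then have "y + (t * s) *\<^sub>R (q - y) \<in> affine hull \<sigma>"
        using rel_interior_subset[of "convex hull \<sigma>"] convex_hull_subset_affine_hull[of \<sigma>] by blast
      then have "\<not> aff_dim \<sigma> < aff_dim P" using elim(2) \<Sigma>(1)[OF \<sigma>(1)] unfolding \<A>_def by blast
      moreover have "aff_dim \<sigma> \<le> aff_dim P" using \<Sigma>(1)[OF \<sigma>(1)] P(3) by (intro aff_dim_subset) auto
      ultimately show ?case using \<sigma> by (auto simp: T_def)
    qed
    then have "\<exists>\<^sub>F t in at_right 0. \<exists>\<sigma>\<in>T. ?Q s y \<sigma> t"
      by (intro eventually_frequently) auto
    from frequently_bex_finite[OF \<open>finite T\<close> this]
    obtain \<sigma> where \<sigma>: "\<sigma> \<in> T" "\<exists>\<^sub>F t in at_right 0. ?Q s y \<sigma> t" ..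
    show ?thesis using vis2[OF \<sigma>(1) that(2) \<sigma>(2)] \<sigma>(1) by (rule bexI)
  qed
  have K1: "K 1 \<sigma> = J \<sigma>" for \<sigma> by (simp add: K_def J_def)
  have K2: "K (- 1) \<sigma> = \<sigma> - J \<sigma>" if "\<sigma> \<in> T" for \<sigma> using J_compl[OF that] by (simp add: K_def)
  have simplex_P: "convex hull \<sigma> \<subseteq> P" if "\<sigma> \<in> T" for \<sigma>
    using T(2)[OF that] unfolding P_def by (rule hull_mono)
  have closed: "P = (\<Union>\<sigma>\<in>T. half_open_simplex \<sigma> (K 1 \<sigma>))"
  proof
    show "(\<Union>\<sigma>\<in>T. half_open_simplex \<sigma> (K 1 \<sigma>)) \<subseteq> P"
      using half_open_simplex_subset T(4) simplex_P by blast
    show "P \<subseteq> (\<Union>\<sigma>\<in>T. half_open_simplex \<sigma> (K 1 \<sigma>))"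
    proof
      fix y assume y: "y \<in> P"
      have "\<forall>\<^sub>F t in at_right 0. t < (1::real)" using eventually_at_right_real[of 0 "1::real"] by (auto elim: eventually_mono)
      with eventually_at_right_less[of "0::real"]
      have "\<forall>\<^sub>F t in at_right 0. y + (t * 1) *\<^sub>R (q - y) \<in> P"
      proof eventually_elim
        case (elim t)
        have "(1 - t) *\<^sub>R y + t *\<^sub>R q \<in> P" using elim y P(1) qP by (intro convexD_alt) auto
        then show ?case by (simp add: algebra_simps)
      qed
      then show "y \<in> (\<Union>\<sigma>\<in>T. half_open_simplex \<sigma> (K 1 \<sigma>))"
        using cover[of 1 y] hull_inc[OF y, of affine] by auto
    qed
  qed
  have "rel_interior P = (\<Union>\<sigma>\<in>T. half_open_simplex \<sigma> (K (- 1) \<sigma>))"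
  proof
    show "(\<Union>\<sigma>\<in>T. half_open_simplex \<sigma> (K (- 1) \<sigma>)) \<subseteq> rel_interior P"
    proof clarify
      fix \<sigma> y assume \<sigma>: "\<sigma> \<in> T" and y: "y \<in> half_open_simplex \<sigma> (K (- 1) \<sigma>)"
      from eventually_conj[OF eventually_at_right_less[of "0::real"] vis1[OF \<sigma> y]]
      obtain t where t: "0 < t" "?Q (- 1) y \<sigma> t"
        using eventually_happens[of _ "at_right (0::real)"] by auto
      \<comment> \<open>y lies between q and z, a point of P beyond y\<close>
      define z where "z = y + (t * - 1) *\<^sub>R (q - y)"
      have "z \<in> P" using t(2) rel_interior_subset[of "convex hull \<sigma>"] simplex_P[OF \<sigma>] unfolding z_def by blast
      then have "z - (t / (1 + t)) *\<^sub>R (z - q) \<in> rel_interior P"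
        using t(1) by (intro rel_interior_convex_shrink[OF P(1) q(1)]) auto
      moreover have "z - (t / (1 + t)) *\<^sub>R (z - q) = y"
      proof -
        have "z - q = (1 + t) *\<^sub>R (y - q)" by (simp add: z_def algebra_simps)
        then have "(t / (1 + t)) *\<^sub>R (z - q) = t *\<^sub>R (y - q)" using t(1) by simp
        then show ?thesis by (simp add: z_def algebra_simps)
      qed
      ultimately show "y \<in> rel_interior P" by simp
    qed
    show "rel_interior P \<subseteq> (\<Union>\<sigma>\<in>T. half_open_simplex \<sigma> (K (- 1) \<sigma>))"
    proof
      fix y assume "y \<in> rel_interior P"
      then obtain e where y: "y \<in> P" "0 < e" "ball y e \<inter> affine hull P \<subseteq> P"
        by (auto simp: mem_rel_interior_ball)
      have y_aff: "y \<in> affine hull P" using y(1) by (rule hull_inc)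
      have "((\<lambda>t. y + (t * - 1) *\<^sub>R (q - y)) \<longlongrightarrow> y + (0 * - 1) *\<^sub>R (q - y)) (at_right 0)"
        by (intro tendsto_intros)
      then have "\<forall>\<^sub>F t in at_right 0. y + (t * - 1) *\<^sub>R (q - y) \<in> ball y e"
        using y(2) by (intro topological_tendstoD) auto
      then have "\<forall>\<^sub>F t in at_right 0. y + (t * - 1) *\<^sub>R (q - y) \<in> P"
      proof eventually_elim
        case (elim t)
        have "(1 + t) *\<^sub>R y + (- t) *\<^sub>R q \<in> affine hull P"
          using y_aff q_aff by (intro mem_affine) auto
        then have "y + (t * - 1) *\<^sub>R (q - y) \<in> affine hull P" by (simp add: algebra_simps)
        then show ?case using elim y(3) by blast
      qed
      then show "y \<in> (\<Union>\<sigma>\<in>T. half_open_simplex \<sigma> (K (- 1) \<sigma>))"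
        using cover[of "- 1" y] y_aff by auto
    qed
  qed
  then have opened: "rel_interior P = (\<Union>\<sigma>\<in>T. half_open_simplex \<sigma> (\<sigma> - J \<sigma>))"
    using K2 by auto
  have "disjoint_family_on (\<lambda>\<sigma>. half_open_simplex \<sigma> (\<sigma> - J \<sigma>)) T"
    using disjoint[of "- 1"] K2 by (simp add: disjoint_family_on_def)
  moreover have "\<sigma> \<subseteq> V \<and> \<not> affine_dependent \<sigma> \<and> int (card \<sigma>) = aff_dim P + 1" if "\<sigma> \<in> T" for \<sigma>
    using T[OF that] aff_dim_affine_independent[of \<sigma>] by simp
  moreover have "J \<sigma> \<subseteq> \<sigma> \<and> J \<sigma> \<noteq> {}" if "\<sigma> \<in> T" for \<sigma>
    using J_ne[OF that] by (auto simp: J_def)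
  ultimately show thesis
    using that[of T J] \<open>finite T\<close> closed opened disjoint[of 1] unfolding K1 P_def by blast
qed

section \<open>Reciprocity for discrete moment tensors\<close>

lemma comb_image_cone_slice:
  assumes "0 < k"
  shows "comb \<sigma> ` cone_slice \<sigma> J k = (\<lambda>x. real_of_int k *\<^sub>R x) ` half_open_simplex \<sigma> J \<inter> int_lattice"
proof (intro equalityI subsetI)
  fix x assume "x \<in> comb \<sigma> ` cone_slice \<sigma> J k"
  then obtain \<mu> where \<mu>: "\<mu> \<in> cone_slice \<sigma> J k" "x = comb \<sigma> \<mu>" by blast
  let ?\<nu> = "\<lambda>v. (1 / of_int k) * \<mu> v"
  have "sum ?\<nu> \<sigma> = 1"
    using \<mu> assms unfolding sum_distrib_left[symmetric] by (simp add: cone_slice_def)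
  then have "comb \<sigma> ?\<nu> \<in> half_open_simplex \<sigma> J"
    using \<mu> assms by (auto simp: half_open_simplex_def cone_slice_def intro!: exI[of _ ?\<nu>])
  moreover have "x = of_int k *\<^sub>R comb \<sigma> ?\<nu>"
    using assms \<mu>(2) unfolding comb_scaleR by simp
  ultimately show "x \<in> (\<lambda>x. of_int k *\<^sub>R x) ` half_open_simplex \<sigma> J \<inter> int_lattice"
    using \<mu> by (auto simp: cone_slice_def)
next
  fix x assume "x \<in> (\<lambda>x. of_int k *\<^sub>R x) ` half_open_simplex \<sigma> J \<inter> int_lattice"
  then obtain \<mu> where \<mu>: "\<forall>v\<in>\<sigma>. 0 \<le> \<mu> v \<and> (v \<notin> J \<longrightarrow> 0 < \<mu> v)" "sum \<mu> \<sigma> = 1"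
    "x = of_int k *\<^sub>R comb \<sigma> \<mu>" "x \<in> int_lattice" by (auto simp: half_open_simplex_def)
  let ?\<nu> = "\<lambda>v. if v \<in> \<sigma> then of_int k * \<mu> v else 0"
  have "comb \<sigma> ?\<nu> = x"
    unfolding \<mu>(3) comb_scaleR[symmetric] by (rule comb_cong) simp
  moreover have "?\<nu> \<in> cone_slice \<sigma> J k"
    using \<mu> calculation assms by (simp add: cone_slice_def flip: sum_distrib_left)
  ultimately show "x \<in> comb \<sigma> ` cone_slice \<sigma> J k" by blast
qed

lemma sum_lattice_points_half_open_decomposition:
  assumes "finite T" "\<And>\<sigma>. \<sigma> \<in> T \<Longrightarrow> finite \<sigma> \<and> \<not> affine_dependent \<sigma>"
    and S: "S = (\<Union>\<sigma>\<in>T. half_open_simplex \<sigma> (J \<sigma>))" "disjoint_family_on (\<lambda>\<sigma>. half_open_simplex \<sigma> (J \<sigma>)) T"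
    and k: "0 < k"
  shows "(\<Sum>x \<in> (\<lambda>x. real_of_int k *\<^sub>R x) ` S \<inter> int_lattice. f x) =
    (\<Sum>\<sigma>\<in>T. \<Sum>\<mu>\<in>cone_slice \<sigma> (J \<sigma>) k. f (comb \<sigma> \<mu>))"
proof -
  let ?C = "\<lambda>\<sigma>. comb \<sigma> ` cone_slice \<sigma> (J \<sigma>) k"
  have "(\<lambda>x. real_of_int k *\<^sub>R x) ` S \<inter> int_lattice = (\<Union>\<sigma>\<in>T. ?C \<sigma>)"
    unfolding comb_image_cone_slice[OF k] S(1) by blast
  then have "(\<Sum>x \<in> (\<lambda>x. real_of_int k *\<^sub>R x) ` S \<inter> int_lattice. f x) = sum f (\<Union>\<sigma>\<in>T. ?C \<sigma>)" by simp
  also have "\<dots> = (\<Sum>\<sigma>\<in>T. sum f (?C \<sigma>))"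
  proof (rule sum.UNION_disjoint)
    show "\<forall>\<sigma>\<in>T. finite (?C \<sigma>)" using assms(2) finite_cone_slice by blast
    have "inj (\<lambda>x :: real ^ 'a. real_of_int k *\<^sub>R x)" using k by (simp add: inj_on_def)
    then show "\<forall>\<sigma>\<in>T. \<forall>\<tau>\<in>T. \<sigma> \<noteq> \<tau> \<longrightarrow> ?C \<sigma> \<inter> ?C \<tau> = {}"
      using S(2) unfolding comb_image_cone_slice[OF k] disjoint_family_on_def inj_def by blast
  qed (rule assms(1))
  also have "\<dots> = (\<Sum>\<sigma>\<in>T. \<Sum>\<mu>\<in>cone_slice \<sigma> (J \<sigma>) k. f (comb \<sigma> \<mu>))"
    using assms(2) by (intro sum.cong) (auto simp: sum.reindex inj_on_comb_cone_slice)
  finally show ?thesis .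
qed

text \<open>
  The dilation by zero collapses a nonempty polytope to the origin, where tensor powers of positive rank vanish;
  hence the Ehrhart expansion has no constant term.
\<close>

lemma discrete_moment_tensor_dilate_0:
  assumes "r \<ge> 1"
  shows "discrete_moment_tensor r ((\<lambda>x. 0 *\<^sub>R x) ` P) v = 0"
proof -
  have "tensor_power r x v = 0" if "x \<in> (\<lambda>x. 0 *\<^sub>R x) ` P \<inter> int_lattice" for x
  proof -
    have "x = 0" using that by auto
    then show ?thesis using assms by (simp add: tensor_power_def)
  qed
  then show ?thesis by (simp add: discrete_moment_tensor_def)
qed

text \<open>
  For a fixed argument \<open>v\<close>, the half-open decompositions of \<open>P\<close> and of its relative interior reduce the assertion
  to the simplices. The sign is the same for all of them, as they all have the dimension of \<open>P\<close>.
\<close>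

lemma discrete_moment_reciprocity:
  fixes P :: "(real ^ 'n) set"
  assumes r: "r \<ge> 1" and P: "lattice_polytope P"
  obtains p :: "real poly" where "degree p \<le> nat (aff_dim P + int r)" "coeff p 0 = 0"
    "\<And>k. discrete_moment_tensor r ((\<lambda>x. real k *\<^sub>R x) ` P) v = poly p (real k)"
    "discrete_moment_tensor r (rel_interior P) v = (- 1) ^ nat (aff_dim P + int r) * poly p (- 1)"
proof (cases "P = {}")
  case True
  then show thesis by (intro that[of 0]) (simp_all add: discrete_moment_tensor_def)
next
  case False
  define V where "V = {x. x extreme_point_of P}"
  have "polytope P" and lat: "V \<subseteq> int_lattice" using P by (auto simp: lattice_polytope_def V_def)
  have PV: "P = convex hull V"
    unfolding V_def using \<open>polytope P\<close> by (intro Krein_Milman_Minkowski polytope_imp_compact polytope_imp_convex)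
  have V: "finite V"
    unfolding V_def by (rule finite_polyhedron_extreme_points[OF polytope_imp_polyhedron[OF \<open>polytope P\<close>]])
  have "V \<noteq> {}" using PV False convex_hull_eq_empty[of V] by metis
  obtain T J where T: "finite T"
    "\<forall>\<sigma>\<in>T. \<sigma> \<subseteq> V \<and> \<not> affine_dependent \<sigma> \<and> int (card \<sigma>) = aff_dim P + 1"
    "\<forall>\<sigma>\<in>T. J \<sigma> \<subseteq> \<sigma> \<and> J \<sigma> \<noteq> {}"
    and closed: "P = (\<Union>\<sigma>\<in>T. half_open_simplex \<sigma> (J \<sigma>))"
      "disjoint_family_on (\<lambda>\<sigma>. half_open_simplex \<sigma> (J \<sigma>)) T"
    and opened: "rel_interior P = (\<Union>\<sigma>\<in>T. half_open_simplex \<sigma> (\<sigma> - J \<sigma>))"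
      "disjoint_family_on (\<lambda>\<sigma>. half_open_simplex \<sigma> (\<sigma> - J \<sigma>)) T"
  proof (rule exists_half_open_decomposition[OF V \<open>V \<noteq> {}\<close>, folded PV], goal_cases)
    case (1 T J)
    show thesis by (rule 1(1)[OF 1(2-)])
  qed
  define d where "d = nat (aff_dim P + int r)"
  have fin: "finite \<sigma>" if "\<sigma> \<in> T" for \<sigma> using T(2)[rule_format, OF that] finite_subset[OF _ V] by blast
  have indep: "finite \<sigma> \<and> \<not> affine_dependent \<sigma>" if "\<sigma> \<in> T" for \<sigma> using fin T(2) that by blast
  have card: "card \<sigma> - 1 + r = d" if "\<sigma> \<in> T" for \<sigma>
    using T(2)[rule_format, OF that] T(3)[rule_format, OF that] fin[OF that] card_gt_0_iff[of \<sigma>] by (auto simp: d_def)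
  let ?f = "\<lambda>x. \<Prod>j<r. x \<bullet> v j"
  have "\<exists>p :: real poly. degree p \<le> d \<and>
      (\<forall>k. (\<Sum>\<mu>\<in>cone_slice \<sigma> (J \<sigma>) (int k). ?f (comb \<sigma> \<mu>)) = poly p (real k)) \<and>
      (\<Sum>\<mu>\<in>cone_slice \<sigma> (\<sigma> - J \<sigma>) 1. ?f (comb \<sigma> \<mu>)) = (- 1) ^ d * poly p (- 1)"
    if \<sigma>: "\<sigma> \<in> T" for \<sigma>
  proof -
    have "\<sigma> \<subseteq> int_lattice" "\<not> affine_dependent \<sigma>" "J \<sigma> \<subseteq> \<sigma>" "J \<sigma> \<noteq> {}"
      using T(2,3)[rule_format, OF \<sigma>] lat by auto
    from half_open_simplex_reciprocity[OF fin[OF \<sigma>] this(2,1,3,4), of r v]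
    show ?thesis unfolding card[OF \<sigma>] by metis
  qed
  then obtain p where p: "\<And>\<sigma>. \<sigma> \<in> T \<Longrightarrow> degree (p \<sigma>) \<le> d"
    "\<And>\<sigma> k. \<sigma> \<in> T \<Longrightarrow> (\<Sum>\<mu>\<in>cone_slice \<sigma> (J \<sigma>) (int k). ?f (comb \<sigma> \<mu>)) = poly (p \<sigma> :: real poly) (real k)"
    "\<And>\<sigma>. \<sigma> \<in> T \<Longrightarrow> (\<Sum>\<mu>\<in>cone_slice \<sigma> (\<sigma> - J \<sigma>) 1. ?f (comb \<sigma> \<mu>)) = (- 1) ^ d * poly (p \<sigma>) (- 1)"
    by metis
  have p0: "poly (p \<sigma>) 0 = 0" if \<sigma>: "\<sigma> \<in> T" for \<sigma>
  proof -
    have "?f (comb \<sigma> \<mu>) = 0" if "\<mu> \<in> cone_slice \<sigma> (J \<sigma>) (int 0)" for \<mu>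
    proof -
      have "\<forall>v\<in>\<sigma>. \<mu> v = 0" using that sum_nonneg_eq_0_iff[OF fin[OF \<sigma>], of \<mu>] by (auto simp: cone_slice_def)
      then have "comb \<sigma> \<mu> = 0" by (simp add: comb_def)
      then show ?thesis using r by simp
    qed
    then have "(\<Sum>\<mu>\<in>cone_slice \<sigma> (J \<sigma>) (int 0). ?f (comb \<sigma> \<mu>)) = 0"
      by (intro sum.neutral ballI)
    then show ?thesis unfolding p(2)[OF \<sigma>] by simp
  qed
  let ?p = "smult (1 / fact r) (\<Sum>\<sigma>\<in>T. p \<sigma>)"
  show thesis
  proof (rule that[of ?p, folded d_def])
    show "degree ?p \<le> d" using p(1) T(1) by (auto intro: degree_sum_le)
    show "coeff ?p 0 = 0" using p0 by (simp add: coeff_sum poly_0_coeff_0)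
    show "discrete_moment_tensor r ((\<lambda>x. real k *\<^sub>R x) ` P) v = poly ?p (real k)" for k
    proof (cases "k = 0")
      case True
      then show ?thesis using p0 discrete_moment_tensor_dilate_0[OF r, of P v] by (simp add: poly_sum)
    next
      case False
      then show ?thesis
        using sum_lattice_points_half_open_decomposition[OF T(1) indep closed, of "int k" ?f]
        by (simp add: discrete_moment_tensor_def tensor_power_def poly_sum p(2))
    qed
    show "discrete_moment_tensor r (rel_interior P) v = (- 1) ^ d * poly ?p (- 1)"
      using sum_lattice_points_half_open_decomposition[OF T(1) indep opened, of 1 ?f]
      by (simp add: discrete_moment_tensor_def tensor_power_def poly_sum p(3) flip: sum_distrib_left)
  qed
qed

lemma poly_eqI_of_nat:
  fixes p q :: "real poly"
  assumes "\<And>k. poly p (real k) = poly q (real k)"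
  shows "p = q"
proof (rule ccontr)
  assume "p \<noteq> q"
  then have "finite {x. poly (p - q) x = 0}" by (intro poly_roots_finite) simp
  moreover have "range real \<subseteq> {x. poly (p - q) x = 0}" using assms by auto
  ultimately have "finite (range real)" using finite_subset by blast
  then show False by (simp add: finite_image_iff inj_on_def)
qed

lemma poly_as_sum_from_1:
  fixes p :: "real poly"
  assumes "degree p \<le> N" "coeff p 0 = 0"
  shows "poly p x = (\<Sum>i = 1..N. coeff p i * x ^ i)"
proof -
  have "poly p x = (\<Sum>i\<le>N. coeff p i * x ^ i)"
    unfolding poly_altdef using assms(1)
    by (intro sum.mono_neutral_left) (auto simp: coeff_eq_0)
  also have "\<dots> = (\<Sum>i = 1..N. coeff p i * x ^ i)"
    using assms(2) by (intro sum.mono_neutral_right) (auto simp: not_less_eq_eq)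
  finally show ?thesis .
qed

text \<open>
  The coefficients of a polynomial are determined by its values at natural numbers, so identities between the
  tensors \<open>D k\<close>, valid for all \<open>k\<close>, pass to the coefficients.
\<close>

lemma interpolated_coeff_in_sym_tensors:
  assumes D: "\<And>k. D k \<in> sym_tensors r" and p: "\<And>v k. D k v = poly (p v) (real k)"
  shows "(\<lambda>v. coeff (p v) i) \<in> sym_tensors r"
proof -
  have "p v = p w" if "\<forall>j<r. v j = w j" for v w
    by (rule poly_eqI_of_nat) (use D that in \<open>auto simp: sym_tensors_def simp flip: p\<close>)
  moreover have "linear (\<lambda>x. coeff (p (v(j := x))) i)" if "j < r" for v j
  proof -
    have lin: "linear (\<lambda>x. D k (v(j := x)))" for k
      using D[of k] that by (simp add: sym_tensors_def)
    have "p (v(j := x + y)) = p (v(j := x)) + p (v(j := y))" for x y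
      by (rule poly_eqI_of_nat) (simp add: linear_add[OF lin] flip: p)
    moreover have "p (v(j := a *\<^sub>R x)) = smult a (p (v(j := x)))" for a x
      by (rule poly_eqI_of_nat) (simp add: linear_cmul[OF lin] flip: p)
    ultimately show ?thesis by (simp add: linear_iff)
  qed
  moreover have "p (v \<circ> \<pi>) = p v" if "\<pi> permutes {..<r}" for v \<pi>
    by (rule poly_eqI_of_nat) (use D that in \<open>simp add: sym_tensors_def flip: p\<close>)
  ultimately show ?thesis unfolding sym_tensors_def by (intro CollectI conjI allI impI) metis+
qed

theorem theorem2:
  fixes P :: "(real ^ 'n) set" and r :: nat
  assumes "r \<ge> 1" and "lattice_polytope P"
  shows "discrete_moment_tensor r (rel_interior P) =
    (\<lambda>v. (-1) ^ nat (aff_dim P + int r) *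
      (\<Sum>i = 1..nat (aff_dim P + int r). (-1) ^ i * ehrhart_tensor r i P v))"
proof
  fix v
  let ?d = "nat (aff_dim P + int r)" and ?N = "CARD('n) + r"
  have dN: "?d \<le> ?N" using aff_dim_le_DIM[of P] by simp
  have "\<exists>p :: real poly. degree p \<le> ?d \<and> coeff p 0 = 0 \<and>
    (\<forall>k. discrete_moment_tensor r ((\<lambda>x. real k *\<^sub>R x) ` P) v = poly p (real k)) \<and>
    discrete_moment_tensor r (rel_interior P) v = (- 1) ^ ?d * poly p (- 1)" for v
    using discrete_moment_reciprocity[OF assms, of v] by metis
  then obtain p :: "_ \<Rightarrow> real poly" where p: "\<And>v. degree (p v) \<le> ?d" "\<And>v. coeff (p v) 0 = 0"
    "\<And>v k. discrete_moment_tensor r ((\<lambda>x. real k *\<^sub>R x) ` P) v = poly (p v) (real k)"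
    "\<And>v. discrete_moment_tensor r (rel_interior P) v = (- 1) ^ ?d * poly (p v) (- 1)"
    by metis
  have "ehrhart_expansion r P (\<lambda>i v. coeff (p v) i)"
    unfolding ehrhart_expansion_def
  proof (intro conjI ballI allI ext)
    show "(\<lambda>v. coeff (p v) i) \<in> sym_tensors r" for i
      by (rule interpolated_coeff_in_sym_tensors[OF discrete_moment_tensor_in_sym_tensors p(3)])
    show "discrete_moment_tensor r ((\<lambda>x. real k *\<^sub>R x) ` P) v =
        (\<Sum>i = 1..?N. coeff (p v) i * real k ^ i)" for k v
      unfolding p(3) using p(1)[of v] dN p(2) by (intro poly_as_sum_from_1) simp_all
  qed
  then have "ehrhart_tensor r i P v = coeff (p v) i" if "i \<in> {1..?d}" for i
    using ehrhart_tensor_eq[of r P] that dN by simp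
  then show "discrete_moment_tensor r (rel_interior P) v =
    (-1) ^ ?d * (\<Sum>i = 1..?d. (-1) ^ i * ehrhart_tensor r i P v)"
    unfolding p(4) poly_as_sum_from_1[OF p(1,2)] by (simp add: mult.commute)
qed

end
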